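(* Let $r\ge 0$ be an integer. The following spaces of differential $1$-forms on the triangle $T^2$ have bases that are $S_3$-invariant up to sign if and only if the corresponding condition holds: \begin{itemize} \item $\mathcal P_r\Lambda^1(T^2)$ if and only if $r\notin 3\mathbb N_0$; \item $\mathcal P_r^-\Lambda^1(T^2)$ if and only if $r\notin 3\mathbb N_0+2$; \item $\mathring{\mathcal P}_r\Lambda^1(T^2)$ if and only if $r\notin 3\mathbb N_0+3$; \item $\mathring{\mathcal P}_r^-\Lambda^1(T^2)$ if and only if $r\notin 3\mathbb N_0+2$. \end{itemize}
   Context: $T^n\subset\mathbb R^{n+1}$ is the standard simplex $\{(\lambda_0,\dots,\lambda_n):\lambda_i\ge 0,\ \sum_i\lambda_i=1\}$. $\mathcal P_r\Lambda^k(\mathbb R^{n+1})$ denotes the $k$-forms on $\mathbb R^{n+1}$ with polynomial coefficients of degree at most $r$ (zero if $r<0$). With $X$ the position vector field on $\mathbb R^{n+1}$ and $i_X$ contraction with $X$, $\mathcal P_r^-\Lambda^k(\mathbb R^{n+1}):=i_X\bigl(\mathcal P_{r-1}\Lambda^{k+1}(\mathbb R^{n+1})\bigr)$. The spaces $\mathcal P_r\Lambda^k(T^n)$ and $\mathcal P_r^-\Lambda^k(T^n)$ are the images of these spaces under restriction (pullback) to $T^n$. $\mathring{\mathcal P}_r\Lambda^k(T^n)$, $\mathring{\mathcal P}_r^-\Lambda^k(T^n)$ denote the subspaces of forms whose trace (pullback) vanishes on every $(n-1)$-dimensional face of $T^n$. The symmetric group $S_{n+1}$ (permutations of $\{0,\dots,n\}$)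 acts on these spaces as follows: for $\pi\in S_{n+1}$ let $S_\pi(\lambda_0,\dots,\lambda_n)=(\lambda_{\pi(0)},\dots,\lambda_{\pi(n)})$, and let $\pi$ act on forms by the pullback $S_\pi^*$. A basis $\xi_1,\dots,\xi_m$ of a representation $V$ of a group $G$ is $G$-invariant up to sign if for every $g\in G$ and every $i$ there is $i'$ with $g\xi_i=\pm\xi_{i'}$. $\mathbb N_0=\{0,1,2,\dots\}$ and $3\mathbb N_0+a=\{3m+a:m\in\mathbb N_0\}$. *)

theory Defs
  imports Complex_Main "HOL-Combinatorics.Permutations"
begin

text \<open>Points of R^3 are functions nat => real supported on {0,1,2}
  (coordinates lambda_0, lambda_1, lambda_2).\<close>

type_synonym pt = "nat \<Rightarrow> real"

text \<open>A 1-form on T^2 is represented by its (normalised) action on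
  pairs (point of T^2, tangent vector of T^2); it is 0 outside this domain,
  so two forms with equal restriction to T^2 are equal as functions.\<close>
type_synonym form1 = "pt \<Rightarrow> pt \<Rightarrow> real"

definition monom3 :: "nat \<times> nat \<times> nat \<Rightarrow> pt \<Rightarrow> real" where
  "monom3 a x = (case a of (a0, a1, a2) \<Rightarrow> x 0 ^ a0 * x 1 ^ a1 * x 2 ^ a2)"

definition mdeg :: "nat \<times> nat \<times> nat \<Rightarrow> nat" where
  "mdeg a = (case a of (a0, a1, a2) \<Rightarrow> a0 + a1 + a2)"

text \<open>Polynomials of degree at most k in lambda_0, lambda_1, lambda_2
  (the zero polynomial only, if k < 0).\<close>
definition poly3 :: "int \<Rightarrow> (pt \<Rightarrow> real) set" where
  "poly3 k = {p. \<exists>c. p = (\<lambda>x. \<Sum>a\<in>{a. int (mdeg a) \<le> k}. c a * monom3 a x)}"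

definition in_T :: "pt \<Rightarrow> bool" where
  "in_T x \<longleftrightarrow> (\<forall>i<3. 0 \<le> x i) \<and> (\<forall>i\<ge>3. x i = 0) \<and> x 0 + x 1 + x 2 = 1"

definition tangentT :: "pt \<Rightarrow> bool" where
  "tangentT v \<longleftrightarrow> (\<forall>i\<ge>3. v i = 0) \<and> v 0 + v 1 + v 2 = 0"

text \<open>Restriction (pullback) to T^2 of the 1-form sum_k w_k d lambda_k on R^3.\<close>
definition trT :: "(nat \<Rightarrow> pt \<Rightarrow> real) \<Rightarrow> form1" where
  "trT w = (\<lambda>x v. if in_T x \<and> tangentT v then (\<Sum>k<3. w k x * v k) else 0)"

definition PL1 :: "nat \<Rightarrow> form1 set" where
  "PL1 r = {trT w | w. \<forall>k<3. w k \<in> poly3 (int r)}"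

text \<open>Contraction i_X of the 2-form sum_{i<j} q_ij d lambda_i /\ d lambda_j with the
  position vector field X: coefficient of d lambda_k.\<close>
definition contrX :: "(nat \<Rightarrow> nat \<Rightarrow> pt \<Rightarrow> real) \<Rightarrow> nat \<Rightarrow> pt \<Rightarrow> real" where
  "contrX q k x = (\<Sum>i<k. q i k x * x i) - (\<Sum>j\<in>{k<..<3}. q k j x * x j)"

definition PmL1 :: "nat \<Rightarrow> form1 set" where
  "PmL1 r = {trT (contrX q) | q. \<forall>i j. i < j \<and> j < 3 \<longrightarrow> q i j \<in> poly3 (int r - 1)}"

definition zero_trace :: "form1 \<Rightarrow> bool" where
  "zero_trace F \<longleftrightarrow> (\<forall>i<3. \<forall>x v. in_T x \<and> x i = 0 \<and> tangentT v \<and> v i = 0 \<longrightarrow> F x v = 0)"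

definition PL1_0 :: "nat \<Rightarrow> form1 set" where
  "PL1_0 r = {F \<in> PL1 r. zero_trace F}"

definition PmL1_0 :: "nat \<Rightarrow> form1 set" where
  "PmL1_0 r = {F \<in> PmL1 r. zero_trace F}"

definition S3act :: "(nat \<Rightarrow> nat) \<Rightarrow> form1 \<Rightarrow> form1" where
  "S3act \<pi> F = (\<lambda>x v. F (x \<circ> \<pi>) (v \<circ> \<pi>))"

definition lincomb :: "(form1 \<Rightarrow> real) \<Rightarrow> form1 set \<Rightarrow> form1" where
  "lincomb c B = (\<lambda>x v. \<Sum>b\<in>B. c b * b x v)"

definition is_basis :: "form1 set \<Rightarrow> form1 set \<Rightarrow> bool" where
  "is_basis V B \<longleftrightarrow> finite B \<and> B \<subseteq> V
     \<and> (\<forall>c. lincomb c B = (\<lambda>x v. 0) \<longrightarrow> (\<forall>b\<in>B. c b = 0))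
     \<and> (\<forall>F\<in>V. \<exists>c. F = lincomb c B)"

definition has_S3_sign_invariant_basis :: "form1 set \<Rightarrow> bool" where
  "has_S3_sign_invariant_basis V \<longleftrightarrow> (\<exists>B. is_basis V B \<and>
     (\<forall>\<pi>. \<pi> permutes {0, 1, 2} \<longrightarrow>
        (\<forall>b\<in>B. S3act \<pi> b \<in> B \<or> (\<lambda>x v. - S3act \<pi> b x v) \<in> B)))"

end

theory Submission
  imports Defs "HOL-Computational_Algebra.Polynomial"
begin

text \<open>
  Each of the four spaces is spanned by forms \<open>u (d, k)\<close> indexed by a multidegree \<open>d\<close> with
  \<open>d\<^sub>0 + d\<^sub>1 + d\<^sub>2 = N\<close> and an index \<open>k < 3\<close>, permuted by the symmetric group up to a global sign. For each
  \<open>d\<close>, either all three indices occur and \<open>u (d, 0) + u (d, 1) + u (d, 2) = 0\<close>, or at most one of them occurs,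
  and there are no other relations.

  If 3 does not divide \<open>N\<close>, exactly two of the exponents in \<open>d\<close> agree modulo 3, which singles out an index \<open>s\<close>
  equivariantly. Then \<open>u (d, s)\<close> and \<open>u (d, s + 1) - u (d, s + 2)\<close> form the basis, together
  with the forms \<open>u (d, k)\<close> that are alone in their multidegree.

  In a basis that is invariant up to sign, the 3-cycle has nonnegative trace: if it maps a basis element \<open>b\<close> to
  \<open>\<plusminus>b\<close>, the sign is \<open>+\<close> because its cube is the identity. But if \<open>(m, m, m)\<close> occurs as a multidegree,
  this is the only one fixed by the 3-cycle, and it contributes trace \<open>-1\<close>.
\<close>

section \<open>Finite families of forms\<close>

text \<open>Because the coordinates sum to 1 on the triangle, every polynomial of degree at most r
  is the restriction of a homogeneous one of degree r, so a single total degree N suffices: N = r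
  for full polynomial forms, and N = r + 1 for the minus spaces, whose generators have coefficients
  of degree r - 1 and a Whitney factor that counts as degree 2. The trace -1 arises as follows:
  three vectors with sum zero that span a plane are permuted cyclically, so the trace is that of a
  cyclic permutation matrix, 0, minus 1 for the trivial line that the relation removes. A
  multidegree that the 3-cycle moves has no diagonal entries. The choice of basis has a similar
  source: if 3 does not divide N, the stabiliser of d is at most the transposition fixing s. It
  exchanges the other two forms up to a common sign, so it preserves the middle form and their
  difference up to sign. Equivariance of s makes these choices agree along each orbit.\<close>

definition form_span :: "'i set \<Rightarrow> ('i \<Rightarrow> form1) \<Rightarrow> form1 set" where
  "form_span A u = {F. \<exists>c. F = (\<lambda>x v. \<Sum>i\<in>A. c i * u i x v)}"

definition form_indep :: "'i set \<Rightarrow> ('i \<Rightarrow> form1) \<Rightarrow> bool" where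
  "form_indep A u \<longleftrightarrow> (\<forall>c. (\<forall>x v. (\<Sum>i\<in>A. c i * u i x v) = 0) \<longrightarrow> (\<forall>i\<in>A. c i = 0))"

lemma form_span_iff: "F \<in> form_span A u \<longleftrightarrow> (\<exists>c. \<forall>x v. F x v = (\<Sum>i\<in>A. c i * u i x v))"
  unfolding form_span_def by (simp add: fun_eq_iff)

lemma form_spanI: "(\<And>x v. F x v = (\<Sum>i\<in>A. c i * u i x v)) \<Longrightarrow> F \<in> form_span A u"
  unfolding form_span_iff by blast

lemma form_span_base:
  assumes "finite A" "i \<in> A"
  shows "u i \<in> form_span A u"
proof (rule form_spanI[where c = "\<lambda>j. if j = i then 1 else 0"])
  fix x v
  have "(\<Sum>j\<in>A. (if j = i then 1 else 0) * u j x v) = (\<Sum>j\<in>A. if j = i then u j x v else 0)"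
    by (rule sum.cong) auto
  then show "u i x v = (\<Sum>j\<in>A. (if j = i then 1 else 0) * u j x v)"
    using assms by simp
qed

lemma form_span_zero: "(\<lambda>x v. 0) \<in> form_span A u"
  by (rule form_spanI[where c = "\<lambda>_. 0"]) simp

lemma form_span_add:
  assumes "F \<in> form_span A u" "G \<in> form_span A u"
  shows "(\<lambda>x v. F x v + G x v) \<in> form_span A u"
proof -
  obtain c e where "\<And>x v. F x v = (\<Sum>i\<in>A. c i * u i x v)" "\<And>x v. G x v = (\<Sum>i\<in>A. e i * u i x v)"
    using assms unfolding form_span_iff by blast
  then show ?thesis
    by (intro form_spanI[where c = "\<lambda>i. c i + e i"]) (simp add: sum.distrib distrib_right)
qed

lemma form_span_scale:
  assumes "F \<in> form_span A u"
  shows "(\<lambda>x v. a * F x v) \<in> form_span A u"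
proof -
  obtain c where "\<And>x v. F x v = (\<Sum>i\<in>A. c i * u i x v)"
    using assms unfolding form_span_iff by blast
  then show ?thesis
    by (intro form_spanI[where c = "\<lambda>i. a * c i"]) (simp add: sum_distrib_left mult.assoc)
qed

lemma form_span_sum:
  assumes "\<And>j. j \<in> B \<Longrightarrow> G j \<in> form_span A u"
  shows "(\<lambda>x v. \<Sum>j\<in>B. a j * G j x v) \<in> form_span A u"
  using assms
proof (induction B rule: infinite_finite_induct)
  case (insert b B)
  then have "(\<lambda>x v. a b * G b x v) \<in> form_span A u" "(\<lambda>x v. \<Sum>j\<in>B. a j * G j x v) \<in> form_span A u"
    by (auto intro: form_span_scale)
  then show ?case using form_span_add insert.hyps by fastforce
qed (auto simp: form_span_zero)

lemma form_span_mono: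
  assumes "\<And>j. j \<in> B \<Longrightarrow> w j \<in> form_span A u"
  shows "form_span B w \<subseteq> form_span A u"
  using form_span_sum[of B w A u] assms by (auto simp: form_span_def[of B])

text \<open>\<open>is_basis\<close> speaks of a set, so passing from a family to its image needs
  injectivity: a repeated member would give a relation with coefficients 1 and -1.\<close>

lemma form_indep_inj_on:
  assumes "finite A" "form_indep A u"
  shows "inj_on u A"
proof (rule inj_onI, rule ccontr)
  fix i j assume ij: "i \<in> A" "j \<in> A" "u i = u j" "i \<noteq> j"
  define c :: "'a \<Rightarrow> real" where "c k = (if k = i then 1 else 0) - (if k = j then 1 else 0)" for k
  have "(\<Sum>k\<in>A. c k * u k x v) = (\<Sum>k\<in>A. if k = i then u k x v else 0) - (\<Sum>k\<in>A. if k = j then u k x v else 0)"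
    for x v
    unfolding sum_subtractf[symmetric] by (rule sum.cong) (auto simp: c_def)
  then have "(\<Sum>k\<in>A. c k * u k x v) = 0" for x v
    using ij assms(1) by simp
  then have "c i = 0" using assms(2) ij unfolding form_indep_def by blast
  then show False using ij by (simp add: c_def)
qed

lemma is_basis_image:
  assumes "finite A" "form_indep A u"
  shows "is_basis (form_span A u) (u ` A)"
proof -
  have inj: "inj_on u A" by (rule form_indep_inj_on[OF assms])
  have lin: "lincomb c (u ` A) = (\<lambda>x v. \<Sum>i\<in>A. c (u i) * u i x v)" for c
    by (simp add: lincomb_def sum.reindex[OF inj])
  have zero: "\<forall>b\<in>u ` A. c b = 0" if "lincomb c (u ` A) = (\<lambda>x v. 0)" for c
  proof -
    have "\<forall>x v. (\<Sum>i\<in>A. c (u i) * u i x v) = 0" using that unfolding lin by metis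
    then have "\<forall>i\<in>A. c (u i) = 0"
      using assms(2) unfolding form_indep_def by (elim allE[of _ "\<lambda>i. c (u i)"]) blast
    then show ?thesis by blast
  qed
  have span: "\<exists>c. F = lincomb c (u ` A)" if F: "F \<in> form_span A u" for F
  proof -
    obtain c where c: "F = (\<lambda>x v. \<Sum>i\<in>A. c i * u i x v)"
      using F unfolding form_span_def by blast
    have "lincomb (\<lambda>b. c (inv_into A u b)) (u ` A) = F"
      unfolding lin c by (intro ext sum.cong refl) (simp add: inv_into_f_f[OF inj])
    then show ?thesis by blast
  qed
  have "u ` A \<subseteq> form_span A u" using assms(1) by (auto intro: form_span_base)
  moreover have "\<forall>c. lincomb c (u ` A) = (\<lambda>x v. 0) \<longrightarrow> (\<forall>b\<in>u ` A. c b = 0)"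
    by (intro allI impI, erule zero)
  moreover have "\<forall>F\<in>form_span A u. \<exists>c. F = lincomb c (u ` A)"
    by (intro ballI, erule span)
  ultimately show ?thesis unfolding is_basis_def
    using assms(1) by (intro conjI finite_imageI) assumption+
qed

lemma is_basis_form_indep: "is_basis V B \<Longrightarrow> form_indep B (\<lambda>b. b)"
  by (auto simp: is_basis_def form_indep_def lincomb_def fun_eq_iff)

lemma is_basis_spans: "is_basis V B \<Longrightarrow> F \<in> V \<Longrightarrow> F \<in> form_span B (\<lambda>b. b)"
  unfolding is_basis_def lincomb_def form_span_def by auto

section \<open>The trace as an obstruction\<close>

lemma form_indep_unique:
  assumes "form_indep A u" "\<And>x v. (\<Sum>i\<in>A. c i * u i x v) = (\<Sum>i\<in>A. e i * u i x v)" "i \<in> A"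
  shows "c i = e i"
proof -
  have "(\<Sum>i\<in>A. (c i - e i) * u i x v) = 0" for x v
    using assms(2)[of x v] by (simp add: left_diff_distrib sum_subtractf)
  then have "c i - e i = 0"
    using assms(1)[unfolded form_indep_def, rule_format, of "\<lambda>i. c i - e i"] assms(3) by blast
  then show ?thesis by simp
qed

text \<open>With the change of basis matrices \<open>Q\<close> (from \<open>u\<close> to
  \<open>w\<close>) and \<open>P\<close> (back), uniqueness of coefficients gives QP = 1 and L =
  PMQ. Hence tr L = tr(MQP) = tr M.\<close>

lemma trace_basis_independent:
  assumes fin: "finite A" "finite B"
    and ind: "form_indep A u" "form_indep B w"
    and uw: "\<And>i. i \<in> A \<Longrightarrow> u i \<in> form_span B w"
    and wu: "\<And>j. j \<in> B \<Longrightarrow> w j \<in> form_span A u"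
    and M: "\<And>i x v. i \<in> A \<Longrightarrow> S3act \<pi> (u i) x v = (\<Sum>k\<in>A. M i k * u k x v)"
    and L: "\<And>j x v. j \<in> B \<Longrightarrow> S3act \<pi> (w j) x v = (\<Sum>k\<in>B. L j k * w k x v)"
  shows "(\<Sum>i\<in>A. M i i) = (\<Sum>j\<in>B. L j j)"
proof -
  have "\<forall>i\<in>A. \<exists>c. \<forall>x v. u i x v = (\<Sum>j\<in>B. c j * w j x v)"
    using uw unfolding form_span_iff by blast
  then obtain Q where Q: "\<And>i x v. i \<in> A \<Longrightarrow> u i x v = (\<Sum>j\<in>B. Q i j * w j x v)"
    by metis
  have "\<forall>j\<in>B. \<exists>c. \<forall>x v. w j x v = (\<Sum>i\<in>A. c i * u i x v)"
    using wu unfolding form_span_iff by blast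
  then obtain P where P: "\<And>j x v. j \<in> B \<Longrightarrow> w j x v = (\<Sum>i\<in>A. P j i * u i x v)"
    by metis
  have QP: "(\<Sum>j\<in>B. Q i j * P j k) = (if k = i then 1 else 0)" if "i \<in> A" "k \<in> A" for i k
  proof (rule form_indep_unique[OF ind(1) _ that(2)])
    fix x v
    have "(\<Sum>k\<in>A. (\<Sum>j\<in>B. Q i j * P j k) * u k x v) = (\<Sum>k\<in>A. \<Sum>j\<in>B. Q i j * (P j k * u k x v))"
      by (simp add: sum_distrib_right mult.assoc)
    also have "\<dots> = (\<Sum>j\<in>B. Q i j * (\<Sum>k\<in>A. P j k * u k x v))"
      by (subst sum.swap) (simp add: sum_distrib_left)
    also have "\<dots> = (\<Sum>j\<in>B. Q i j * w j x v)" using P by simp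
    also have "\<dots> = u i x v" using Q that by simp
    also have "\<dots> = (\<Sum>k\<in>A. if k = i then u k x v else 0)" using fin that by simp
    also have "\<dots> = (\<Sum>k\<in>A. (if k = i then 1 else 0) * u k x v)"
      by (rule sum.cong) auto
    finally show "(\<Sum>k\<in>A. (\<Sum>j\<in>B. Q i j * P j k) * u k x v) = (\<Sum>k\<in>A. (if k = i then 1 else 0) * u k x v)" .
  qed
  have LPMQ: "L j l = (\<Sum>i\<in>A. \<Sum>k\<in>A. P j i * M i k * Q k l)" if "j \<in> B" "l \<in> B" for j l
  proof (rule form_indep_unique[OF ind(2) _ that(2)])
    fix x v
    have "(\<Sum>l\<in>B. (\<Sum>i\<in>A. \<Sum>k\<in>A. P j i * M i k * Q k l) * w l x v)
        = (\<Sum>l\<in>B. \<Sum>i\<in>A. \<Sum>k\<in>A. P j i * (M i k * (Q k l * w l x v)))"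
      by (simp add: sum_distrib_right mult.assoc)
    also have "\<dots> = (\<Sum>i\<in>A. \<Sum>l\<in>B. \<Sum>k\<in>A. P j i * (M i k * (Q k l * w l x v)))"
      by (rule sum.swap)
    also have "\<dots> = (\<Sum>i\<in>A. \<Sum>k\<in>A. \<Sum>l\<in>B. P j i * (M i k * (Q k l * w l x v)))"
      by (rule sum.cong[OF refl], rule sum.swap)
    also have "\<dots> = (\<Sum>i\<in>A. P j i * (\<Sum>k\<in>A. M i k * (\<Sum>l\<in>B. Q k l * w l x v)))"
      by (simp add: sum_distrib_left)
    also have "\<dots> = (\<Sum>i\<in>A. P j i * (\<Sum>k\<in>A. M i k * u k x v))" using Q by simp
    also have "\<dots> = (\<Sum>i\<in>A. P j i * S3act \<pi> (u i) x v)" using M by simp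
    also have "\<dots> = S3act \<pi> (w j) x v" using P that by (simp add: S3act_def)
    finally show "(\<Sum>l\<in>B. L j l * w l x v) = (\<Sum>l\<in>B. (\<Sum>i\<in>A. \<Sum>k\<in>A. P j i * M i k * Q k l) * w l x v)"
      using L[OF that(1)] by simp
  qed
  have "(\<Sum>j\<in>B. L j j) = (\<Sum>j\<in>B. \<Sum>i\<in>A. \<Sum>k\<in>A. P j i * M i k * Q k j)"
    using LPMQ by simp
  also have "\<dots> = (\<Sum>i\<in>A. \<Sum>j\<in>B. \<Sum>k\<in>A. P j i * M i k * Q k j)" by (rule sum.swap)
  also have "\<dots> = (\<Sum>i\<in>A. \<Sum>k\<in>A. \<Sum>j\<in>B. P j i * M i k * Q k j)"
    by (rule sum.cong[OF refl], rule sum.swap)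
  also have "\<dots> = (\<Sum>i\<in>A. \<Sum>k\<in>A. M i k * (\<Sum>j\<in>B. Q k j * P j i))"
    by (simp add: sum_distrib_left mult_ac)
  also have "\<dots> = (\<Sum>i\<in>A. \<Sum>k\<in>A. if k = i then M i k else 0)"
    by (intro sum.cong refl) (auto simp: QP)
  also have "\<dots> = (\<Sum>i\<in>A. M i i)" using fin by simp
  finally show ?thesis by simp
qed

text \<open>In an invariant basis \<open>B\<close> the action is a signed permutation matrix
  \<open>L\<close> with diagonal entries 0 or 1. The trace is then carried over to the given family
  \<open>u\<close>, which is independent but need not be invariant.\<close>

lemma trace_nonneg_if_sign_invariant_basis:
  assumes V: "has_S3_sign_invariant_basis (form_span A u)"
    and A: "finite A" "form_indep A u"
    and \<pi>: "\<pi> permutes {0, 1, 2}" "\<pi> \<circ> \<pi> \<circ> \<pi> = id"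
    and M: "\<And>i x v. i \<in> A \<Longrightarrow> S3act \<pi> (u i) x v = (\<Sum>k\<in>A. M i k * u k x v)"
  shows "0 \<le> (\<Sum>i\<in>A. M i i)"
proof -
  obtain B where B: "is_basis (form_span A u) B"
    and inv: "\<And>b. b \<in> B \<Longrightarrow> S3act \<pi> b \<in> B \<or> (\<lambda>x v. - S3act \<pi> b x v) \<in> B"
    using V \<pi>(1) unfolding has_S3_sign_invariant_basis_def by blast
  have finB: "finite B" and BV: "B \<subseteq> form_span A u" using B by (auto simp: is_basis_def)
  have indB: "form_indep B (\<lambda>b. b)" by (rule is_basis_form_indep[OF B])
  have "\<forall>b\<in>B. \<exists>e t. (e = 1 \<or> e = -1) \<and> t \<in> B \<and> (\<forall>x v. S3act \<pi> b x v = e * t x v)"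
  proof
    fix b assume "b \<in> B"
    from inv[OF this] show "\<exists>e t. (e = 1 \<or> e = -1) \<and> t \<in> B \<and> (\<forall>x v. S3act \<pi> b x v = e * t x v)"
    proof
      assume "S3act \<pi> b \<in> B"
      then show ?thesis by (intro exI[of _ 1] exI[of _ "S3act \<pi> b"]) auto
    next
      assume "(\<lambda>x v. - S3act \<pi> b x v) \<in> B"
      then show ?thesis by (intro exI[of _ "-1"] exI[of _ "\<lambda>x v. - S3act \<pi> b x v"]) auto
    qed
  qed
  then obtain e t where et: "\<And>b. b \<in> B \<Longrightarrow> e b = 1 \<or> e b = (-1::real)" "\<And>b. b \<in> B \<Longrightarrow> t b \<in> B"
    "\<And>b x v. b \<in> B \<Longrightarrow> S3act \<pi> b x v = e b * t b x v"
    by metis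
  define L where "L b k = (if k = t b then e b else 0)" for b k
  have L: "S3act \<pi> b x v = (\<Sum>k\<in>B. L b k * k x v)" if "b \<in> B" for b x v
  proof -
    have "(\<Sum>k\<in>B. L b k * k x v) = (\<Sum>k\<in>B. if k = t b then e b * k x v else 0)"
      by (rule sum.cong) (auto simp: L_def)
    then show ?thesis using finB et that by simp
  qed
  have "0 \<le> L b b" if b: "b \<in> B" for b
  proof (rule ccontr)
    assume "\<not> 0 \<le> L b b"
    then have "t b = b" "e b = -1" using et(1)[OF b] by (auto simp: L_def split: if_splits)
    then have neg: "b (x \<circ> \<pi>) (v \<circ> \<pi>) = - b x v" for x v
      using et(3)[OF b] by (simp add: S3act_def)
    \<comment> \<open>Three applications give the sign (-1)^3, while the cube of
      \<open>\<pi>\<close> is the identity: b = -b, so a member of an independent set would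
      vanish.\<close>
    have "b (x \<circ> \<pi> \<circ> \<pi> \<circ> \<pi>) (v \<circ> \<pi> \<circ> \<pi> \<circ> \<pi>) = - b x v" for x v
      by (simp add: neg)
    moreover have "x \<circ> \<pi> \<circ> \<pi> \<circ> \<pi> = x" for x :: pt
      using \<pi>(2) by (metis comp_assoc comp_id)
    ultimately have "b x v = 0" for x v by (metis add.inverse_inverse equal_neg_zero)
    then have "(\<Sum>k\<in>B. (if k = b then 1 else 0) * k x v) = 0" for x v
      by (intro sum.neutral) auto
    then have "(if b = b then 1 else 0 :: real) = 0"
      using indB[unfolded form_indep_def, rule_format, of "\<lambda>k. if k = b then 1 else 0" b] b by blast
    then show False by simp
  qed
  then have "0 \<le> (\<Sum>b\<in>B. L b b)" by (rule sum_nonneg)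
  also have "\<dots> = (\<Sum>i\<in>A. M i i)"
    by (rule sym, rule trace_basis_independent[OF A(1) finB A(2) indB _ _ M L])
      (use BV in \<open>auto intro: is_basis_spans[OF B] form_span_base[OF A(1)]\<close>)
  finally show ?thesis .
qed

section \<open>Permutations of three indices\<close>

text \<open>The successor modulo 3, extended by the identity to a permutation of all naturals. For k
  < 3 the two other indices are \<open>rot k\<close> and \<open>rot (rot k)\<close>, which lets one
  statement cover all k.\<close>

definition rot :: "nat \<Rightarrow> nat" where
  "rot k = (if k = 0 then 1 else if k = 1 then 2 else if k = 2 then 0 else k)"

lemma less_3_cases: "k < 3 \<Longrightarrow> k = 0 \<or> k = 1 \<or> k = (2::nat)"
  by auto

lemma rot_simps [simp]: "rot 0 = 1" "rot (Suc 0) = 2" "rot 2 = 0" "rot (rot (rot k)) = k" "k \<ge> 3 \<Longrightarrow> rot k = k"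
  by (auto simp: rot_def)

lemma rot_less_3 [simp]: "rot k < 3 \<longleftrightarrow> k < 3"
  by (auto simp: rot_def)

lemma rot_neq:
  assumes "k < 3"
  shows "rot k \<noteq> k" "rot (rot k) \<noteq> k" "rot (rot k) \<noteq> rot k" "k \<noteq> rot k" "k \<noteq> rot (rot k)"
  using less_3_cases[OF assms] by auto

lemma rot_cases:
  assumes "j < 3" "k < 3"
  shows "j = k \<or> j = rot k \<or> j = rot (rot k)"
  using less_3_cases[OF assms(1)] less_3_cases[OF assms(2)] by auto

lemma rot_inj: "rot j = rot k \<longleftrightarrow> j = k"
  by (metis rot_simps(4))

lemma rot_permutes: "rot permutes {..<3}"
  unfolding permutes_def by (metis lessThan_iff not_le rot_simps(4,5))

lemma rot_cubed: "rot \<circ> rot \<circ> rot = id"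
  by (simp add: fun_eq_iff)

lemma lessThan_3_eq: "{..<3::nat} = {0, 1, 2}"
  by auto

lemma sum_less_3: "(\<Sum>k<3. f k) = f 0 + f 1 + f (2::nat)"
  by (simp add: eval_nat_numeral)

lemma sum_rot:
  assumes "j < 3"
  shows "f j + f (rot j) + f (rot (rot j)) = f 0 + f 1 + (f 2 :: 'a::comm_monoid_add)"
  using less_3_cases[OF assms] by (auto simp: add_ac)

lemma perm_less_3: "\<pi> permutes {..<3} \<Longrightarrow> \<pi> k < 3 \<longleftrightarrow> k < (3::nat)"
  using permutes_in_image[of \<pi> "{..<3}" k] by simp

lemma perm_3_values:
  assumes "\<pi> permutes {..<3::nat}"
  shows "(\<pi> 0, \<pi> 1, \<pi> 2) \<in> {(0,1,2), (1,2,0), (2,0,1), (0,2,1), (1,0,2), (2,1,0)}"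
proof -
  have inj: "inj \<pi>" by (rule permutes_inj[OF assms])
  have "\<pi> k = 0 \<or> \<pi> k = 1 \<or> \<pi> k = 2" if "k < 3" for k
    using perm_less_3[OF assms] that by (intro less_3_cases) simp
  from this[of 0] this[of 1] this[of 2]
  have "\<pi> 0 = 0 \<or> \<pi> 0 = 1 \<or> \<pi> 0 = 2" "\<pi> 1 = 0 \<or> \<pi> 1 = 1 \<or> \<pi> 1 = 2"
    "\<pi> 2 = 0 \<or> \<pi> 2 = 1 \<or> \<pi> 2 = 2"
    by simp_all
  moreover have "\<pi> 0 \<noteq> \<pi> 1" "\<pi> 0 \<noteq> \<pi> 2" "\<pi> 1 \<noteq> \<pi> 2" using inj by (auto simp: inj_eq)
  ultimately show ?thesis by (elim disjE) simp_all
qed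

text \<open>Even permutations preserve the cyclic order and odd ones reverse it. This dichotomy
  stands in for the sign of a permutation throughout.\<close>

lemma perm_rot_cases:
  assumes "\<pi> permutes {..<3}"
  shows "(\<forall>k<3. \<pi> (rot k) = rot (\<pi> k)) \<or> (\<forall>k<3. \<pi> (rot k) = rot (rot (\<pi> k)))"
proof -
  have "(\<forall>k\<in>{0,1,2}. \<pi> (rot k) = rot (\<pi> k)) \<or> (\<forall>k\<in>{0,1,2}. \<pi> (rot k) = rot (rot (\<pi> k)))"
    using perm_3_values[OF assms] by (elim insertE) simp_all
  then show ?thesis unfolding lessThan_3_eq[symmetric] by blast
qed

lemma sum_perm_3:
  assumes "\<pi> permutes {..<3::nat}"
  shows "f (\<pi> 0) + f (\<pi> 1) + f (\<pi> 2) = f 0 + f 1 + (f 2 :: 'a::comm_monoid_add)"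
  using sum.permute[OF assms, of f] by (simp add: sum_less_3 comp_def)

section \<open>Multidegrees\<close>

definition multideg :: "nat \<Rightarrow> (nat \<Rightarrow> nat) set" where
  "multideg N = {d. (\<forall>i\<ge>3. d i = 0) \<and> d 0 + d 1 + d 2 = N}"

lemma multideg_eqI:
  assumes "d \<in> multideg N" "e \<in> multideg M" "d 0 = e 0" "d 1 = e 1" "d 2 = e 2"
  shows "d = e"
proof
  fix i show "d i = e i"
  proof (cases "i < 3")
    case True
    then show ?thesis using less_3_cases assms by metis
  qed (use assms in \<open>auto simp: multideg_def\<close>)
qed

lemma finite_multideg: "finite (multideg N)"
proof (rule inj_on_finite)
  show "inj_on (\<lambda>d. (d 0, d 1, d 2)) (multideg N)"
    by (rule inj_onI) (auto intro: multideg_eqI)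
  show "(\<lambda>d. (d 0, d 1, d 2)) ` multideg N \<subseteq> {..N} \<times> {..N} \<times> {..N}"
    by (auto simp: multideg_def)
qed auto

lemma multideg_comp:
  assumes "\<pi> permutes {..<3}"
  shows "d \<circ> \<pi> \<in> multideg N \<longleftrightarrow> d \<in> multideg N"
proof -
  have "\<pi> i = i" if "i \<ge> 3" for i
    using assms that by (simp add: permutes_not_in)
  then show ?thesis
    using sum_perm_3[OF assms, of d] by (auto simp: multideg_def)
qed

text \<open>The barycentre of the multidegree modulo 3. When \<open>N\<close> is coprime to 3, two of the exponents agree
  modulo 3 and the third one does not; its position is the barycentre, since \<open>N\<close> is its own inverse modulo 3.\<close>
definition centre :: "nat \<Rightarrow> (nat \<Rightarrow> nat) \<Rightarrow> nat" where
  "centre N d = N * (d 1 + 2 * d 2) mod 3"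

lemma centre_less_3 [simp]: "centre N d < 3"
  by (simp add: centre_def)

text \<open>If the residues are b except for a at position s, then N is congruent to a - b and d_1 +
  2 d_2 = 0 d_0 + 1 d_1 + 2 d_2 to (a - b) s; the product is (a - b)^2 s, congruent to s. Residues
  that are all equal or all distinct would make N divisible by 3.\<close>

lemma centre_iff:
  assumes d: "d \<in> multideg N" and N: "N mod 3 \<noteq> 0" and c: "c < 3"
  shows "centre N d = c \<longleftrightarrow> d (rot c) mod 3 = d (rot (rot c)) mod 3"
proof -
  define g0 g1 g2 where g: "g0 = d 0 mod 3" "g1 = d 1 mod 3" "g2 = d 2 mod 3"
  have dN: "d 0 + d 1 + d 2 = N" using d by (simp add: multideg_def)
  then have "centre N d = (d 0 + d 1 + d 2) * (d 1 + 2 * d 2) mod 3" by (simp add: centre_def)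
  also have "\<dots> = (g0 + g1 + g2) * (g1 + 2 * g2) mod 3"
    unfolding g by (intro mod_mult_cong mod_add_cong; simp)
  finally have cen: "centre N d = (g0 + g1 + g2) * (g1 + 2 * g2) mod 3" .
  have "(g0 + g1 + g2) mod 3 = N mod 3"
    unfolding g dN[symmetric] by (intro mod_add_cong; simp)
  then have S: "(g0 + g1 + g2) mod 3 \<noteq> 0" using N by simp
  have "g0 < 3" "g1 < 3" "g2 < 3" by (simp_all add: g)
  note r = this[THEN less_3_cases]
  \<comment> \<open>A finite check over the 27 triples of residues, those with sum divisible by 3
    being excluded by \<open>S\<close>.\<close>
  have "(centre N d = 0 \<longleftrightarrow> g1 = g2) \<and> (centre N d = 1 \<longleftrightarrow> g2 = g0) \<and> (centre N d = 2 \<longleftrightarrow> g0 = g1)"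
    unfolding cen using r S by (elim disjE) simp_all
  then show ?thesis unfolding g using less_3_cases[OF c] by (elim disjE) simp_all
qed

text \<open>The criterion \<open>centre_iff\<close> is symmetric in the two other positions, so it
  is respected by permutations that reverse the cyclic order as well.\<close>

lemma centre_equivariant:
  assumes \<pi>: "\<pi> permutes {..<3}" and d: "d \<in> multideg N" and N: "N mod 3 \<noteq> 0"
  shows "\<pi> (centre N (d \<circ> \<pi>)) = centre N d"
proof -
  define b where "b = centre N (d \<circ> \<pi>)"
  have d': "d \<circ> \<pi> \<in> multideg N" using multideg_comp[OF \<pi>] d by simp
  have b: "b < 3" by (simp add: b_def)
  then have "\<pi> b < 3" using perm_less_3[OF \<pi>] by simp
  moreover have "d (\<pi> (rot b)) mod 3 = d (\<pi> (rot (rot b))) mod 3"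
    using centre_iff[OF d' N b] by (simp add: b_def)
  then have "d (rot (\<pi> b)) mod 3 = d (rot (rot (\<pi> b))) mod 3"
    using perm_rot_cases[OF \<pi>] b by auto
  ultimately show ?thesis using centre_iff[OF d N, of "\<pi> b"] by (simp add: b_def)
qed

section \<open>Families indexed by a multidegree and an index\<close>

text \<open>The common structure of the four spaces; \<open>s\<close> is the sign contributed by odd
  permutations. In \<open>indep\<close> the coefficients vanish off \<open>I\<close>, so it covers
  both kinds of multidegree: with all three indices present it says that \<open>rel\<close> is the
  only relation, and with one missing the common value is 0.\<close>

locale S3_family =
  fixes N :: nat and I :: "((nat \<Rightarrow> nat) \<times> nat) set"
    and u :: "(nat \<Rightarrow> nat) \<times> nat \<Rightarrow> form1" and s :: real
  assumes I_sub: "I \<subseteq> multideg N \<times> {..<3}"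
    and I_fill: "(d, j) \<in> I \<Longrightarrow> (d, k) \<in> I \<Longrightarrow> j \<noteq> k \<Longrightarrow> l < 3 \<Longrightarrow> (d, l) \<in> I"
    and I_perm: "\<pi> permutes {..<3} \<Longrightarrow> k < 3 \<Longrightarrow> (d \<circ> \<pi>, k) \<in> I \<longleftrightarrow> (d, \<pi> k) \<in> I"
    and s: "s = 1 \<or> s = -1"
    and act_even: "\<pi> permutes {..<3} \<Longrightarrow> \<forall>k<3. \<pi> (rot k) = rot (\<pi> k) \<Longrightarrow> (d, \<pi> k) \<in> I \<Longrightarrow> k < 3 \<Longrightarrow>
      S3act \<pi> (u (d \<circ> \<pi>, k)) = u (d, \<pi> k)"
    and act_odd: "\<pi> permutes {..<3} \<Longrightarrow> \<forall>k<3. \<pi> (rot k) = rot (rot (\<pi> k)) \<Longrightarrow> (d, \<pi> k) \<in> I \<Longrightarrow> k < 3 \<Longrightarrow>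
      S3act \<pi> (u (d \<circ> \<pi>, k)) = (\<lambda>x v. s * u (d, \<pi> k) x v)"
    and rel: "(\<And>k. k < 3 \<Longrightarrow> (d, k) \<in> I) \<Longrightarrow> u (d, 0) x v + u (d, 1) x v + u (d, 2) x v = 0"
    and indep: "(\<And>x v. (\<Sum>i\<in>I. c i * u i x v) = 0) \<Longrightarrow> (\<And>i. i \<notin> I \<Longrightarrow> c i = 0) \<Longrightarrow>
      j < 3 \<Longrightarrow> k < 3 \<Longrightarrow> c (d, j) = c (d, k)"
begin

definition full :: "(nat \<Rightarrow> nat) \<Rightarrow> bool" where
  "full d \<longleftrightarrow> (\<forall>k<3. (d, k) \<in> I)"

lemma finite_I: "finite I"
  using I_sub finite_multideg by (meson finite_SigmaI finite_lessThan finite_subset)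

lemma full_perm:
  assumes "\<pi> permutes {..<3}"
  shows "full (d \<circ> \<pi>) \<longleftrightarrow> full d"
proof
  assume "full d"
  then show "full (d \<circ> \<pi>)" using I_perm[OF assms] perm_less_3[OF assms] by (auto simp: full_def)
next
  assume *: "full (d \<circ> \<pi>)"
  show "full d" unfolding full_def
  proof (intro allI impI)
    fix k :: nat assume "k < 3"
    moreover have "\<pi> (inv \<pi> k) = k" using assms by (simp add: permutes_inverses)
    ultimately show "(d, k) \<in> I"
      using * I_perm[OF assms, of "inv \<pi> k" d] perm_less_3[OF assms, of "inv \<pi> k"] by (simp add: full_def)
  qed
qed

lemma full_rel:
  assumes "full d" "j < 3"
  shows "u (d, j) x v + u (d, rot j) x v + u (d, rot (rot j)) x v = 0"
  using rel[of d x v] assms sum_rot[OF assms(2), of "\<lambda>k. u (d, k) x v"] by (simp add: full_def)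

text \<open>Relations have constant coefficients on each multidegree, so one known zero there kills
  all three. A multidegree that is not full supplies it by a missing index; for a full one, each
  basis below has to supply it at some \<open>l\<close>.\<close>

lemma indep_zero:
  assumes "\<And>x v. (\<Sum>i\<in>I. c i * u i x v) = 0" "\<And>i. i \<notin> I \<Longrightarrow> c i = 0"
    and "full d \<Longrightarrow> l < 3 \<and> c (d, l) = 0" "k < 3"
  shows "c (d, k) = 0"
proof (cases "full d")
  case True
  then show ?thesis using indep[OF assms(1,2), of l k d] assms by auto
next
  case False
  then obtain j where "j < 3" "(d, j) \<notin> I" by (auto simp: full_def)
  then show ?thesis using indep[OF assms(1,2), of j k d] assms by auto
qed

lemma act_rot:
  assumes "(d, k) \<in> I"
  shows "S3act rot (u (d, k)) = u (d \<circ> rot \<circ> rot, rot k)" "(d \<circ> rot \<circ> rot, rot k) \<in> I"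
proof -
  \<comment> \<open>The inverse of \<open>rot\<close> is \<open>rot \<circ> rot\<close>; this puts
    \<open>d\<close> into the shape e \<circ> \<open>rot\<close> that the action axioms
    expect.\<close>
  have d: "d \<circ> rot \<circ> rot \<circ> rot = d" by (simp add: fun_eq_iff)
  have k: "k < 3" using assms I_sub by auto
  show I: "(d \<circ> rot \<circ> rot, rot k) \<in> I"
    using I_perm[OF rot_permutes k, of "d \<circ> rot \<circ> rot"] assms by (simp only: d)
  show "S3act rot (u (d, k)) = u (d \<circ> rot \<circ> rot, rot k)"
    using act_even[OF rot_permutes _ I k] unfolding d by (simp del: o_apply add: comp_def)
qed

section \<open>An ordinary basis and the trace of the 3-cycle\<close>

definition reduced :: "((nat \<Rightarrow> nat) \<times> nat) set" where
  "reduced = {(d, k) \<in> I. full d \<longrightarrow> k \<noteq> 2}"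

lemma reduced_sub: "reduced \<subseteq> I"
  by (auto simp: reduced_def)

lemma finite_reduced: "finite reduced"
  using finite_I reduced_sub finite_subset by blast

lemma form_indep_reduced: "form_indep reduced u"
  unfolding form_indep_def
proof (intro allI impI ballI)
  fix c i assume z: "\<forall>x v. (\<Sum>i\<in>reduced. c i * u i x v) = 0" and i: "i \<in> reduced"
  define c' where "c' i = (if i \<in> reduced then c i else 0)" for i
  obtain d k where dk: "i = (d, k)" "(d, k) \<in> I" "k < 3" using i reduced_sub I_sub by (cases i) auto
  have "c' (d, k) = 0"
  proof (rule indep_zero[where l = 2])
    fix x v
    have "(\<Sum>i\<in>I. c' i * u i x v) = (\<Sum>i\<in>reduced. c' i * u i x v)"
      by (rule sum.mono_neutral_right) (use finite_I reduced_sub in \<open>auto simp: c'_def\<close>)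
    then show "(\<Sum>i\<in>I. c' i * u i x v) = 0" using z by (simp add: c'_def)
  qed (use reduced_sub dk in \<open>auto simp: c'_def reduced_def\<close>)
  then show "c i = 0" using i dk by (simp add: c'_def)
qed

lemma form_span_reduced: "form_span reduced u = form_span I u"
proof
  show "form_span reduced u \<subseteq> form_span I u"
    by (rule form_span_mono, rule form_span_base[OF finite_I]) (use reduced_sub in auto)
  show "form_span I u \<subseteq> form_span reduced u"
  proof (rule form_span_mono)
    fix i assume i: "i \<in> I"
    show "u i \<in> form_span reduced u"
    proof (cases "i \<in> reduced")
      case True
      then show ?thesis by (rule form_span_base[OF finite_reduced])
    next
      case False
      then obtain d where d: "i = (d, 2)" "full d" using i by (cases i) (auto simp: reduced_def)
      then have "(d, 0) \<in> reduced" "(d, 1) \<in> reduced" by (auto simp: reduced_def full_def)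
      then have "u (d, 0) \<in> form_span reduced u" "u (d, 1) \<in> form_span reduced u"
        using form_span_base[OF finite_reduced] by auto
      then have "(\<lambda>x v. (-1) * u (d, 0) x v + (-1) * u (d, 1) x v) \<in> form_span reduced u"
        by (intro form_span_add form_span_scale)
      moreover have "u i = (\<lambda>x v. (-1) * u (d, 0) x v + (-1) * u (d, 1) x v)"
      proof (intro ext)
        fix x v
        show "u i x v = (-1) * u (d, 0) x v + (-1) * u (d, 1) x v"
          using full_rel[OF d(2), of 0 x v] d(1) by simp
      qed
      ultimately show ?thesis by simp
    qed
  qed
qed

text \<open>Row \<open>i\<close> expands the rotated form in the basis \<open>reduced\<close>. If
  the rotation lands on the dropped index 2 of a full multidegree \<open>e\<close>, the image is
  rewritten as minus the sum of the two remaining forms at \<open>e\<close>.\<close>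

definition rot_matrix :: "(nat \<Rightarrow> nat) \<times> nat \<Rightarrow> (nat \<Rightarrow> nat) \<times> nat \<Rightarrow> real" where
  "rot_matrix i j = (let e = fst i \<circ> rot \<circ> rot in
     if full e \<and> rot (snd i) = 2 then (if fst j = e then -1 else 0)
     else if j = (e, rot (snd i)) then 1 else 0)"

lemma act_rot_reduced:
  assumes "i \<in> reduced"
  shows "S3act rot (u i) x v = (\<Sum>j\<in>reduced. rot_matrix i j * u j x v)"
proof -
  obtain d k where i: "i = (d, k)" "(d, k) \<in> I" using assms reduced_sub by (cases i) auto
  define e where "e = d \<circ> rot \<circ> rot"
  have k: "k < 3" using i I_sub by auto
  have act: "S3act rot (u i) = u (e, rot k)" "(e, rot k) \<in> I"
    using act_rot[OF i(2)] by (auto simp: e_def i)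
  show ?thesis
  proof (cases "full e \<and> rot k = 2")
    case True
    have sub: "{(e, 0), (e, 1)} \<subseteq> reduced" using True by (auto simp: reduced_def full_def)
    have "(\<Sum>j\<in>reduced. rot_matrix i j * u j x v) = (\<Sum>j\<in>{(e, 0), (e, 1)}. rot_matrix i j * u j x v)"
    proof (rule sum.mono_neutral_right[OF finite_reduced sub], rule ballI)
      fix j assume j: "j \<in> reduced - {(e, 0), (e, 1)}"
      then have "fst j \<noteq> e" using True I_sub less_3_cases by (cases j) (force simp: reduced_def)
      then show "rot_matrix i j * u j x v = 0" using True by (simp add: rot_matrix_def i e_def[symmetric])
    qed
    also have "\<dots> = - u (e, 0) x v - u (e, 1) x v"
      using True by (simp add: rot_matrix_def i e_def[symmetric])
    also have "\<dots> = u (e, rot k) x v" using full_rel[of e 0 x v] True by simp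
    finally show ?thesis using act by simp
  next
    case False
    then have red: "(e, rot k) \<in> reduced" using act(2) by (auto simp: reduced_def)
    have "(\<Sum>j\<in>reduced. rot_matrix i j * u j x v) = (\<Sum>j\<in>reduced. if j = (e, rot k) then u j x v else 0)"
      using False by (intro sum.cong) (auto simp: rot_matrix_def i e_def[symmetric] Let_def)
    then show ?thesis using red finite_reduced act by simp
  qed
qed

text \<open>A diagonal entry can be nonzero only if \<open>rot\<close> fixes the multidegree, which
  makes it constant. At \<open>\<delta>\<close> the form of index 0 goes to that of index 1, with
  diagonal entry 0; the form of index 1 goes to that of index 2, which is minus the sum of the other
  two, with diagonal entry -1.\<close>

lemma rot_matrix_diag:
  assumes i: "i \<in> reduced" and \<delta>: "\<delta> = (\<lambda>k. if k < 3 then m else 0)" "full \<delta>"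
  shows "rot_matrix i i = (if i = (\<delta>, 1) then -1 else 0)"
proof -
  obtain d k where dk: "i = (d, k)" "(d, k) \<in> I" using i reduced_sub by (cases i) auto
  have k: "k < 3" and d: "d \<in> multideg N" using dk I_sub by auto
  have \<delta>N: "\<delta> \<in> multideg N" using \<delta>(2)[unfolded full_def, rule_format, of 0] I_sub by auto
  have \<delta>rot: "\<delta> \<circ> rot \<circ> rot = \<delta>" by (auto simp: \<delta>(1) fun_eq_iff)
  show ?thesis
  proof (cases "d \<circ> rot \<circ> rot = d")
    case True
    then have "d (rot (rot j)) = d j" for j by (metis comp_apply)
    from this[of 0] this[of 1] have "d 2 = d 0" "d 0 = d 1" by simp_all
    moreover have "3 * m = N" using \<delta>N by (simp add: multideg_def \<delta>(1))
    ultimately have "d = \<delta>" using d \<delta>N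
      by (intro multideg_eqI[OF d \<delta>N]) (auto simp: multideg_def \<delta>(1))
    then show ?thesis using less_3_cases[OF k] i \<delta>(2)
      by (auto simp: rot_matrix_def dk \<delta>rot Let_def reduced_def)
  next
    case False
    then have "d \<noteq> \<delta>" using \<delta>rot by metis
    with False show ?thesis by (auto simp: rot_matrix_def dk Let_def)
  qed
qed

theorem no_sign_invariant_basis:
  assumes "(\<lambda>k. if k < 3 then m else 0, 0) \<in> I"
  shows "\<not> has_S3_sign_invariant_basis (form_span I u)"
proof
  assume V: "has_S3_sign_invariant_basis (form_span I u)"
  define \<delta> :: "nat \<Rightarrow> nat" where "\<delta> = (\<lambda>k. if k < 3 then m else 0)"
  have \<delta>rot: "\<delta> \<circ> rot = \<delta>" by (auto simp: \<delta>_def fun_eq_iff)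
  have "(\<delta>, 0) \<in> I" using assms by (simp add: \<delta>_def)
  \<comment> \<open>Rotation fixes \<open>\<delta>\<close> but moves the index, so one index
    produces a second one and \<open>I_fill\<close> the third.\<close>
  then have "(\<delta>, rot 0) \<in> I" using I_perm[OF rot_permutes, of 0 \<delta>] by (simp add: \<delta>rot)
  then have full: "full \<delta>" using I_fill[of \<delta> 0 1] \<open>(\<delta>, 0) \<in> I\<close> by (auto simp: full_def)
  then have red: "(\<delta>, 1) \<in> reduced" by (auto simp: reduced_def full_def)
  have "0 \<le> (\<Sum>i\<in>reduced. rot_matrix i i)"
    by (rule trace_nonneg_if_sign_invariant_basis[OF _ finite_reduced form_indep_reduced _ rot_cubed])
      (use V rot_permutes act_rot_reduced in \<open>simp_all only: form_span_reduced lessThan_3_eq[symmetric]\<close>)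
  also have "\<dots> = (\<Sum>i\<in>reduced. if i = (\<delta>, 1) then -1 else 0)"
    using rot_matrix_diag[OF _ \<delta>_def full] by (intro sum.cong) auto
  also have "\<dots> = -1" using red finite_reduced by simp
  finally show False by simp
qed

section \<open>The basis that is invariant up to sign\<close>

definition centred :: "((nat \<Rightarrow> nat) \<times> nat) set" where
  "centred = {(d, k) \<in> I. full d \<longrightarrow> k \<noteq> rot (rot (centre N d))}"

text \<open>With s the centre, slot s + 1 of a full multidegree carries the difference of the forms
  s + 1 and s + 2, which is why \<open>centred\<close> drops slot s + 2.\<close>

definition centred_form :: "(nat \<Rightarrow> nat) \<times> nat \<Rightarrow> form1" where
  "centred_form i = (if full (fst i) \<and> snd i = rot (centre N (fst i))
     then (\<lambda>x v. u i x v - u (fst i, rot (snd i)) x v) else u i)"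

lemma centred_sub: "centred \<subseteq> I"
  by (auto simp: centred_def)

lemma finite_centred: "finite centred"
  using finite_I centred_sub finite_subset by blast

text \<open>A relation is rewritten in terms of \<open>u\<close>: \<open>c'\<close> has at each
  dropped slot (set \<open>K\<close>) the negative of the coefficient at the difference slot before
  it (set \<open>L\<close>), and \<open>rot\<close> matches \<open>L\<close> with
  \<open>K\<close>.\<close>

lemma form_indep_centred: "form_indep centred centred_form"
  unfolding form_indep_def
proof (intro allI impI ballI)
  fix c i assume z: "\<forall>x v. (\<Sum>i\<in>centred. c i * centred_form i x v) = 0" and i: "i \<in> centred"
  define K where "K = {(d, k) \<in> I. full d \<and> k = rot (rot (centre N d))}"
  define L where "L = {(d, k) \<in> centred. full d \<and> k = rot (centre N d)}"
  define c' where "c' i = (if i \<in> centred then c i else if i \<in> K then - c (fst i, rot (centre N (fst i))) else 0)" for i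
  have IK: "I = centred \<union> K" "centred \<inter> K = {}" by (auto simp: centred_def K_def)
  have finK: "finite K" by (rule finite_subset[OF _ finite_I]) (auto simp: K_def)
  have z': "(\<Sum>i\<in>I. c' i * u i x v) = 0" for x v
  proof -
    have "(\<Sum>i\<in>K. c' i * u i x v) = - (\<Sum>i\<in>K. c (fst i, rot (centre N (fst i))) * u i x v)"
      unfolding sum_negf[symmetric] by (rule sum.cong) (use IK in \<open>auto simp: c'_def\<close>)
    also have "(\<Sum>i\<in>K. c (fst i, rot (centre N (fst i))) * u i x v) = (\<Sum>i\<in>L. c i * u (fst i, rot (snd i)) x v)"
      by (rule sum.reindex_bij_witness[where i = "\<lambda>i. (fst i, rot (snd i))" and j = "\<lambda>i. (fst i, rot (rot (snd i)))"])
        (auto simp: K_def L_def centred_def full_def rot_neq)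
    also have "\<dots> = (\<Sum>i\<in>centred. if i \<in> L then c i * u (fst i, rot (snd i)) x v else 0)"
      by (rule sum.mono_neutral_cong_left[OF finite_centred]) (auto simp: L_def)
    finally have K: "(\<Sum>i\<in>K. c' i * u i x v) = - (\<Sum>i\<in>centred. if i \<in> L then c i * u (fst i, rot (snd i)) x v else 0)" .
    have "(\<Sum>i\<in>I. c' i * u i x v) = (\<Sum>i\<in>centred \<union> K. c' i * u i x v)"
      by (rule sum.cong[OF IK(1) refl])
    also have "\<dots> = (\<Sum>i\<in>centred. c' i * u i x v) + (\<Sum>i\<in>K. c' i * u i x v)"
      by (rule sum.union_disjoint[OF finite_centred finK IK(2)])
    also have "\<dots> = (\<Sum>i\<in>centred. c' i * u i x v) - (\<Sum>i\<in>centred. if i \<in> L then c i * u (fst i, rot (snd i)) x v else 0)"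
      by (simp add: K)
    also have "\<dots> = (\<Sum>i\<in>centred. c i * centred_form i x v)"
      unfolding sum_subtractf[symmetric]
      by (rule sum.cong) (auto simp: c'_def L_def centred_form_def algebra_simps)
    finally show ?thesis using z by simp
  qed
  have c'0: "c' i = 0" if "i \<notin> I" for i using that IK by (auto simp: c'_def)
  obtain d k where dk: "i = (d, k)" "(d, k) \<in> I" "k < 3" using i centred_sub I_sub by (cases i) auto
  have "c' (d, k) = 0"
  proof (rule indep_zero[OF z' c'0])
    assume full: "full d"
    let ?j = "rot (centre N d)"
    have "(d, ?j) \<in> centred" "(d, rot ?j) \<in> K"
      using full by (auto simp: centred_def K_def full_def rot_neq rot_inj)
    moreover from this have "(d, rot ?j) \<notin> centred" using IK by auto
    ultimately have "c' (d, ?j) = c (d, ?j)" "c' (d, rot ?j) = - c (d, ?j)"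
      by (auto simp: c'_def)
    \<comment> \<open>The coefficients at s + 1 and s + 2 are opposite by construction and equal by
      \<open>indep\<close>, hence zero; this feeds \<open>indep_zero\<close>.\<close>
    moreover have "c' (d, ?j) = c' (d, rot ?j)" by (rule indep[OF z' c'0]) auto
    ultimately show "?j < 3 \<and> c' (d, ?j) = 0" by simp
  qed (use dk in auto)
  then show "c i = 0" using i dk by (simp add: c'_def)
qed

lemma form_span_centred: "form_span centred centred_form = form_span I u"
proof
  show "form_span centred centred_form \<subseteq> form_span I u"
  proof (rule form_span_mono)
    fix i assume i: "i \<in> centred"
    then have iI: "i \<in> I" using centred_sub by auto
    show "centred_form i \<in> form_span I u"
    proof (cases "full (fst i) \<and> snd i = rot (centre N (fst i))")
      case True
      then have "(fst i, rot (snd i)) \<in> I" by (auto simp: full_def)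
      then have "(\<lambda>x v. u i x v + (-1) * u (fst i, rot (snd i)) x v) \<in> form_span I u"
        using iI by (intro form_span_add form_span_scale form_span_base[OF finite_I])
      then show ?thesis using True by (simp add: centred_form_def)
    next
      case False
      then show ?thesis using form_span_base[OF finite_I iI, of u] by (simp only: centred_form_def if_False)
    qed
  qed
  show "form_span I u \<subseteq> form_span centred centred_form"
  proof (rule form_span_mono)
    fix i assume i: "i \<in> I"
    obtain d k where dk: "i = (d, k)" "k < 3" using i I_sub by (cases i) auto
    show "u i \<in> form_span centred centred_form"
    proof (cases "full d")
      case False
      then have "i \<in> centred" "centred_form i = u i" using i dk by (auto simp: centred_def centred_form_def)
      then show ?thesis using form_span_base[OF finite_centred, of i centred_form] by simp
    next
      case True
      let ?j = "centre N d"
      have "(d, ?j) \<in> centred" "(d, rot ?j) \<in> centred"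
        using True by (auto simp: centred_def full_def rot_neq rot_inj)
      then have mem: "centred_form (d, ?j) \<in> form_span centred centred_form"
         "centred_form (d, rot ?j) \<in> form_span centred centred_form"
        by (auto intro: form_span_base[OF finite_centred])
      have eq: "centred_form (d, ?j) = u (d, ?j)"
        "centred_form (d, rot ?j) = (\<lambda>x v. u (d, rot ?j) x v - u (d, rot (rot ?j)) x v)"
        using True rot_neq[of ?j] by (auto simp: centred_form_def)
      have "\<exists>a b. u i = (\<lambda>x v. a * centred_form (d, ?j) x v + b * centred_form (d, rot ?j) x v)"
        (is "\<exists>a b. ?P a b")
        using rot_cases[OF dk(2) centre_less_3[of N d]]
      proof (elim disjE)
        assume "k = ?j"
        then have "?P 1 0" by (simp add: dk eq)
        then show ?thesis by blast
      next
        assume k: "k = rot ?j"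
        \<comment> \<open>The forms s + 1 and s + 2 have sum minus the central form and difference
          the other basis form; solving for them produces the halves here and in the next
          case.\<close>
        have "u i x v = (-1/2) * centred_form (d, ?j) x v + (1/2) * centred_form (d, rot ?j) x v" for x v
          unfolding eq dk k using full_rel[OF True, of ?j x v] by (simp add: field_simps)
        then have "?P (-1/2) (1/2)" by (intro ext)
        then show ?thesis by blast
      next
        assume k: "k = rot (rot ?j)"
        have "u i x v = (-1/2) * centred_form (d, ?j) x v + (-1/2) * centred_form (d, rot ?j) x v" for x v
          unfolding eq dk k using full_rel[OF True, of ?j x v] by (simp add: field_simps)
        then have "?P (-1/2) (-1/2)" by (intro ext)
        then show ?thesis by blast
      qed
      then obtain a b where ab: "?P a b" by blast
      show ?thesis unfolding ab by (intro form_span_add form_span_scale mem)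
    qed
  qed
qed

text \<open>Equivariance of the centre sends central slots to central slots and the pair of other
  slots to such a pair. The second alternative in the hypothesis suffices because the centre matters
  only at full multidegrees.\<close>

lemma centred_form_act:
  assumes \<pi>: "\<pi> permutes {..<3}" and N: "N mod 3 \<noteq> 0 \<or> (\<forall>d. \<not> full d)" and i: "i \<in> centred"
  shows "\<exists>j\<in>centred. S3act \<pi> (centred_form i) = centred_form j
    \<or> S3act \<pi> (centred_form i) = (\<lambda>x v. - centred_form j x v)"
proof -
  obtain d k where dk: "i = (d, k)" "(d, k) \<in> I" "k < 3" using i centred_sub I_sub by (cases i) auto
  define e where "e = d \<circ> inv \<pi>"
  have d: "d = e \<circ> \<pi>" using permutes_inv_o(2)[OF \<pi>] by (simp add: e_def comp_assoc)
  have eI: "(e, \<pi> k) \<in> I" using I_perm[OF \<pi> dk(3), of e] dk(2) d by simp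
  have full: "full d \<longleftrightarrow> full e" using full_perm[OF \<pi>, of e] d by simp
  have eN: "e \<in> multideg N" using eI I_sub by auto
  have cen: "centre N e = \<pi> (centre N d)" if "full e"
    using centre_equivariant[OF \<pi> eN] N that d by auto
  have inj: "\<pi> a = \<pi> b \<longleftrightarrow> a = b" for a b using permutes_inj[OF \<pi>] by (auto simp: inj_eq)
  show ?thesis
  proof (cases "full d \<and> k = rot (centre N d)")
    case False
    \<comment> \<open>In a full multidegree slot s + 2 is dropped and slot s + 1 is excluded in this
      case, so only the centre remains.\<close>
    have j: "full e \<Longrightarrow> \<pi> k = centre N e"
      using i False rot_cases[OF dk(3) centre_less_3[of N d]] cen full by (auto simp: dk centred_def)
    have "(e, \<pi> k) \<in> centred" using eI j rot_neq(2)[OF centre_less_3[of N e]] by (auto simp: centred_def)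
    moreover have "centred_form i = u (e \<circ> \<pi>, k)" using False by (auto simp: centred_form_def dk d)
    moreover have "centred_form (e, \<pi> k) = u (e, \<pi> k)"
      using j rot_neq(1)[OF centre_less_3[of N e]] by (auto simp: centred_form_def)
    moreover have "S3act \<pi> (u (e \<circ> \<pi>, k)) = u (e, \<pi> k) \<or> S3act \<pi> (u (e \<circ> \<pi>, k)) = (\<lambda>x v. - u (e, \<pi> k) x v)"
      using perm_rot_cases[OF \<pi>] act_even[OF \<pi> _ eI dk(3)] act_odd[OF \<pi> _ eI dk(3)] s by auto
    ultimately show ?thesis by metis
  next
    case True
    let ?j = "centre N e"
    have fe: "full e" and k: "k = rot (centre N d)" using True full by auto
    have j: "(e, rot ?j) \<in> centred" using fe rot_neq[of ?j] by (auto simp: centred_def full_def rot_inj)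
    have ci: "centred_form i x v = u (e \<circ> \<pi>, k) x v - u (e \<circ> \<pi>, rot k) x v" for x v
      using True by (simp add: centred_form_def dk d)
    have cj: "centred_form (e, rot ?j) x v = u (e, rot ?j) x v - u (e, rot (rot ?j)) x v" for x v
      using fe by (simp add: centred_form_def)
    have S: "S3act \<pi> (centred_form i) x v = S3act \<pi> (u (e \<circ> \<pi>, k)) x v - S3act \<pi> (u (e \<circ> \<pi>, rot k)) x v" for x v
      by (simp add: S3act_def ci)
    have rk: "rot k < 3" using dk by simp
    have eI': "(e, \<pi> (rot k)) \<in> I" using fe perm_less_3[OF \<pi>] rk by (simp add: full_def)
    from perm_rot_cases[OF \<pi>] show ?thesis
    proof
      assume ev: "\<forall>k<3. \<pi> (rot k) = rot (\<pi> k)"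
      then have pk: "\<pi> k = rot ?j" "\<pi> (rot k) = rot (rot ?j)" using k cen[OF fe] by simp_all
      have "S3act \<pi> (centred_form i) = centred_form (e, rot ?j)"
        using act_even[OF \<pi> ev eI dk(3)] act_even[OF \<pi> ev eI' rk] by (intro ext) (simp add: S cj pk)
      then show ?thesis using j by blast
    next
      assume od: "\<forall>k<3. \<pi> (rot k) = rot (rot (\<pi> k))"
      then have pk: "\<pi> k = rot (rot ?j)" "\<pi> (rot k) = rot ?j" using k cen[OF fe] by simp_all
      \<comment> \<open>An odd permutation also exchanges the two terms of the difference, which
        adds a sign to \<open>s\<close>.\<close>
      have "S3act \<pi> (centred_form i) = (\<lambda>x v. - s * centred_form (e, rot ?j) x v)"
        using act_odd[OF \<pi> od eI dk(3)] act_odd[OF \<pi> od eI' rk]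
        by (intro ext) (simp add: S cj pk algebra_simps)
      then show ?thesis using j s by fastforce
    qed
  qed
qed

theorem sign_invariant_basis:
  assumes "N mod 3 \<noteq> 0 \<or> (\<forall>d. \<not> full d)"
  shows "has_S3_sign_invariant_basis (form_span I u)"
  unfolding has_S3_sign_invariant_basis_def
proof (intro exI conjI allI impI ballI)
  show "is_basis (form_span I u) (centred_form ` centred)"
    using is_basis_image[OF finite_centred form_indep_centred] by (simp add: form_span_centred)
next
  fix \<pi> :: "nat \<Rightarrow> nat" and b assume \<pi>: "\<pi> permutes {0, 1, 2}" and "b \<in> centred_form ` centred"
  then obtain i where i: "i \<in> centred" "b = centred_form i" by auto
  obtain j where j: "j \<in> centred" "S3act \<pi> b = centred_form j \<or> S3act \<pi> b = (\<lambda>x v. - centred_form j x v)"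
    using centred_form_act[OF \<pi>[folded lessThan_3_eq] assms i(1)] i(2) by blast
  from j(2) show "S3act \<pi> b \<in> centred_form ` centred \<or> (\<lambda>x v. - S3act \<pi> b x v) \<in> centred_form ` centred"
  proof
    assume "S3act \<pi> b = centred_form j"
    then show ?thesis using j(1) by (intro disjI1) simp
  next
    assume "S3act \<pi> b = (\<lambda>x v. - centred_form j x v)"
    then have "(\<lambda>x v. - S3act \<pi> b x v) = centred_form j" by simp
    then show ?thesis using j(1) by (intro disjI2) simp
  qed
qed

end

section \<open>Monomials on the triangle\<close>

text \<open>Exponents form a function on indices instead of a triple, so that a permutation acts by
  composition.\<close>

definition mono3 :: "(nat \<Rightarrow> nat) \<Rightarrow> pt \<Rightarrow> real" where
  "mono3 d x = x 0 ^ d 0 * x 1 ^ d 1 * x 2 ^ d 2"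

lemma prod_perm_3:
  assumes "\<pi> permutes {..<3::nat}"
  shows "f (\<pi> 0) * f (\<pi> 1) * f (\<pi> 2) = f 0 * f 1 * (f 2 :: 'a::comm_monoid_mult)"
  using prod.permute[OF assms, of f] by (simp add: comp_def eval_nat_numeral)

lemma mono3_perm: "\<pi> permutes {..<3} \<Longrightarrow> mono3 (d \<circ> \<pi>) (x \<circ> \<pi>) = mono3 d x"
  using prod_perm_3[of \<pi> "\<lambda>k. x k ^ d k"] by (simp add: mono3_def)

lemma mono3_rot:
  assumes "j < 3"
  shows "mono3 d x = x j ^ d j * x (rot j) ^ d (rot j) * x (rot (rot j)) ^ d (rot (rot j))"
  using less_3_cases[OF assms] by (auto simp: mono3_def)

lemma multideg_rot:
  assumes "j < 3" "d \<in> multideg N"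
  shows "d j + d (rot j) + d (rot (rot j)) = N"
  using sum_rot[OF assms(1), of d] assms(2) by (simp add: multideg_def)

lemma in_T_perm:
  assumes "\<pi> permutes {..<3}"
  shows "in_T (x \<circ> \<pi>) \<longleftrightarrow> in_T x"
proof -
  have fix3: "\<pi> i = i" if "i \<ge> 3" for i using assms that by (simp add: permutes_not_in)
  have "(\<forall>i<3. 0 \<le> x (\<pi> i)) \<longleftrightarrow> (\<forall>i<3. 0 \<le> x i)"
    using permutes_image[OF assms] by (metis (no_types, lifting) image_iff lessThan_iff)
  then show ?thesis using sum_perm_3[OF assms, of x] fix3 by (auto simp: in_T_def)
qed

lemma tangentT_perm:
  assumes "\<pi> permutes {..<3}"
  shows "tangentT (v \<circ> \<pi>) \<longleftrightarrow> tangentT v"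
proof -
  have "\<pi> i = i" if "i \<ge> 3" for i using assms that by (simp add: permutes_not_in)
  then show ?thesis using sum_perm_3[OF assms, of v] by (auto simp: tangentT_def)
qed

text \<open>The sum is a polynomial in t that vanishes on a half-line, hence has infinitely many
  roots. Only positive t are available because the substituted points must lie in the
  triangle.\<close>

lemma exponential_sum_zero:
  fixes a :: "'i \<Rightarrow> real"
  assumes J: "finite J" "inj_on f J" and z: "\<And>t. t > 0 \<Longrightarrow> (\<Sum>j\<in>J. a j * t ^ f j) = 0" and j: "j \<in> J"
  shows "a j = 0"
proof -
  define p where "p = (\<Sum>j\<in>J. monom (a j) (f j))"
  have "poly p t = 0" if "t > 0" for t
    using z[OF that] by (simp add: p_def poly_sum poly_monom)
  then have "{0<..} \<subseteq> {t. poly p t = 0}" by auto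
  then have "infinite {t. poly p t = 0}" using infinite_Ioi finite_subset by blast
  then have "p = 0" using poly_roots_finite by blast
  then have "0 = coeff p (f j)" by simp
  also have "\<dots> = (\<Sum>k\<in>J. if k = j then a k else 0)"
    unfolding p_def coeff_sum using J(2) j by (intro sum.cong) (auto simp: inj_on_eq_iff)
  finally show ?thesis using J(1) j by simp
qed

text \<open>Kronecker substitution: along the curve \<open>(t\<^bsup>N+1\<^esup> : t : 1)\<close> different monomials of degree \<open>N\<close>
  become different powers of \<open>t\<close>.\<close>
lemma mono3_indep:
  assumes z: "\<And>x. in_T x \<Longrightarrow> (\<And>i. i < 3 \<Longrightarrow> x i > 0) \<Longrightarrow> (\<Sum>d\<in>multideg N. a d * mono3 d x) = 0"
    and d: "d \<in> multideg N"
  shows "a d = 0"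
proof (rule exponential_sum_zero[OF finite_multideg _ _ d])
  define f :: "(nat \<Rightarrow> nat) \<Rightarrow> nat" where "f d = (N + 1) * d 0 + d 1" for d
  show "inj_on f (multideg N)"
  proof (rule inj_onI)
    fix d e assume de: "d \<in> multideg N" "e \<in> multideg N" "f d = f e"
    \<comment> \<open>\<open>f d\<close> has the digits \<open>d 0\<close> and \<open>d 1\<close> in
      base N + 1, so both can be read off; the total degree then determines
      \<open>d 2\<close>.\<close>
    have "d 1 < N + 1" "e 1 < N + 1" using de by (auto simp: multideg_def)
    then have "d 0 = f d div (N + 1)" "e 0 = f e div (N + 1)" "d 1 = f d mod (N + 1)" "e 1 = f e mod (N + 1)"
      by (simp_all add: f_def del: mult_Suc Suc_eq_plus1 add_Suc_right One_nat_def)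
    then have "d 0 = e 0" "d 1 = e 1" using de(3) by simp_all
    then show "d = e" using de by (intro multideg_eqI[OF de(1,2)]) (auto simp: multideg_def)
  qed
  fix t :: real assume t: "t > 0"
  \<comment> \<open>Dividing by \<open>S\<close> moves the point of the curve into the plane of
    coordinate sum 1; by homogeneity this costs only the common factor S^N.\<close>
  define S where "S = t ^ (N + 1) + t + 1"
  have S: "S > 0" using t by (simp add: S_def add_pos_pos)
  define x :: pt where "x = (\<lambda>i. if i = 0 then t ^ (N + 1) / S else if i = 1 then t / S else if i = 2 then 1 / S else 0)"
  have pos: "x i > 0" if "i < 3" for i using less_3_cases[OF that] t S by (auto simp: x_def)
  have "x 0 = t ^ (N + 1) / S" "x 1 = t / S" "x 2 = 1 / S" by (simp_all add: x_def)
  then have "x 0 + x 1 + x 2 = S / S" by (simp only: add_divide_distrib[symmetric] S_def[symmetric])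
  then have T: "in_T x" using S pos by (auto simp: in_T_def less_imp_le) (simp add: x_def)
  have m: "mono3 e x = t ^ f e / S ^ N" if "e \<in> multideg N" for e
  proof -
    have "S ^ N = S ^ e 0 * S ^ e 1 * S ^ e 2" using that by (simp add: multideg_def flip: power_add)
    then show ?thesis
      by (simp add: mono3_def x_def f_def power_divide power_add power_mult_distrib flip: power_mult)
  qed
  have "0 = (\<Sum>d\<in>multideg N. a d * mono3 d x)" using z[OF T pos] by simp
  also have "\<dots> = (\<Sum>d\<in>multideg N. a d * t ^ f d) / S ^ N"
    unfolding sum_divide_distrib by (rule sum.cong) (simp_all add: m)
  finally show "(\<Sum>d\<in>multideg N. a d * t ^ f d) = 0" using S by simp
qed

text \<open>On the edge where coordinate i vanishes only the monomials with \<open>d i = 0\<close>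
  survive. Among these the exponent at \<open>rot i\<close> determines \<open>d\<close>, so the
  substitution (t : 1) along the edge separates them.\<close>

lemma mono3_indep_edge:
  assumes i: "i < 3"
    and z: "\<And>x. in_T x \<Longrightarrow> x i = 0 \<Longrightarrow> x (rot i) > 0 \<Longrightarrow> x (rot (rot i)) > 0 \<Longrightarrow>
      (\<Sum>d\<in>multideg N. a d * mono3 d x) = 0"
    and d: "d \<in> multideg N" "d i = 0"
  shows "a d = 0"
proof -
  define J where "J = {d \<in> multideg N. d i = 0}"
  have J: "finite J" "d \<in> J" using finite_multideg d by (simp_all add: J_def)
  have inj: "inj_on (\<lambda>d. d (rot i)) J"
  proof (rule inj_onI)
    fix d e assume de: "d \<in> J" "e \<in> J" "d (rot i) = e (rot i)"
    then have "d (rot (rot i)) = e (rot (rot i))" using multideg_rot[OF i, of d N] multideg_rot[OF i, of e N]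
      by (simp add: J_def)
    then have "d k = e k" if "k < 3" for k using rot_cases[OF that i] de by (auto simp: J_def)
    then show "d = e" using de by (intro multideg_eqI[of d N e N]) (auto simp: J_def)
  qed
  have "(\<Sum>d\<in>J. a d * t ^ d (rot i)) = 0" if t: "t > 0" for t
  proof -
    define x :: pt where "x = (\<lambda>k. if k = rot i then t / (1 + t) else if k = rot (rot i) then 1 / (1 + t) else 0)"
    have x: "x i = 0" "x (rot i) = t / (1 + t)" "x (rot (rot i)) = 1 / (1 + t)"
      using rot_neq[OF i] by (simp_all add: x_def)
    have "x i + x (rot i) + x (rot (rot i)) = 1" using t by (simp add: x flip: add_divide_distrib)
    then have "x 0 + x 1 + x 2 = 1" using sum_rot[OF i, of x] by metis
    moreover have "x k \<ge> 0" for k using t by (simp add: x_def)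
    moreover have "x k = 0" if "k \<ge> 3" for k
    proof -
      have "k \<noteq> rot i" "k \<noteq> rot (rot i)" using i that rot_less_3 by (metis not_less)+
      then show ?thesis by (simp add: x_def)
    qed
    ultimately have T: "in_T x" by (simp add: in_T_def)
    \<comment> \<open>The convention 0^0 = 1 is what keeps the monomials with
      \<open>e i = 0\<close>.\<close>
    have m: "mono3 e x = (if e i = 0 then t ^ e (rot i) / (1 + t) ^ N else 0)" if "e \<in> multideg N" for e
      using multideg_rot[OF i that] by (auto simp: mono3_rot[OF i] x power_divide simp flip: power_add)
    have "0 = (\<Sum>d\<in>multideg N. a d * mono3 d x)" using z[OF T] x t by simp
    also have "\<dots> = (\<Sum>d\<in>J. a d * t ^ d (rot i) / (1 + t) ^ N)"
      by (rule sum.mono_neutral_cong_right[OF finite_multideg]) (auto simp: J_def m)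
    also have "\<dots> = (\<Sum>d\<in>J. a d * t ^ d (rot i)) / (1 + t) ^ N" by (simp add: sum_divide_distrib)
    finally show ?thesis using t by simp
  qed
  then show ?thesis by (rule exponential_sum_zero[OF J(1) inj _ J(2)])
qed

section \<open>Homogenization of polynomials on the triangle\<close>

definition triple_deg :: "nat \<times> nat \<times> nat \<Rightarrow> nat \<Rightarrow> nat" where
  "triple_deg a = (case a of (a0, a1, a2) \<Rightarrow> (\<lambda>i. if i = 0 then a0 else if i = 1 then a1 else if i = 2 then a2 else 0))"

lemma monom3_eq_mono3: "monom3 a = mono3 (triple_deg a)"
  by (auto simp: fun_eq_iff monom3_def mono3_def triple_deg_def split: prod.split)

lemma triple_deg_in_multideg: "triple_deg a \<in> multideg (mdeg a)"
  by (auto simp: mdeg_def triple_deg_def multideg_def split: prod.split)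

lemma finite_mdeg_le: "finite {a. int (mdeg a) \<le> k}"
proof (rule finite_subset)
  show "{a. int (mdeg a) \<le> k} \<subseteq> {..nat k} \<times> {..nat k} \<times> {..nat k}"
    by (auto simp: mdeg_def)
qed auto

lemma poly3_add: "p \<in> poly3 k \<Longrightarrow> q \<in> poly3 k \<Longrightarrow> (\<lambda>x. p x + q x) \<in> poly3 k"
  unfolding poly3_def
proof clarify
  fix c e :: "nat \<times> nat \<times> nat \<Rightarrow> real"
  show "\<exists>ca. (\<lambda>x. (\<Sum>a | int (mdeg a) \<le> k. c a * monom3 a x) + (\<Sum>a | int (mdeg a) \<le> k. e a * monom3 a x)) =
      (\<lambda>x. \<Sum>a | int (mdeg a) \<le> k. ca a * monom3 a x)"
    by (rule exI[of _ "\<lambda>a. c a + e a"]) (simp add: sum.distrib distrib_right)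
qed

lemma poly3_scale: "p \<in> poly3 k \<Longrightarrow> (\<lambda>x. b * p x) \<in> poly3 k"
  unfolding poly3_def
proof clarify
  fix c :: "nat \<times> nat \<times> nat \<Rightarrow> real"
  show "\<exists>ca. (\<lambda>x. b * (\<Sum>a | int (mdeg a) \<le> k. c a * monom3 a x)) = (\<lambda>x. \<Sum>a | int (mdeg a) \<le> k. ca a * monom3 a x)"
    by (rule exI[of _ "\<lambda>a. b * c a"]) (simp add: sum_distrib_left mult.assoc)
qed

lemma poly3_zero: "(\<lambda>x. 0) \<in> poly3 k"
  unfolding poly3_def by (auto intro!: exI[of _ "\<lambda>_. 0"])

lemma mono3_in_poly3:
  assumes "d \<in> multideg n"
  shows "mono3 d \<in> poly3 (int n)"
proof -
  define b where "b = (d 0, d 1, d 2)"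
  have b: "int (mdeg b) \<le> int n" using assms by (simp add: b_def mdeg_def multideg_def)
  have "triple_deg b = d"
    by (rule multideg_eqI[OF triple_deg_in_multideg assms]) (simp_all add: b_def triple_deg_def)
  then have m: "monom3 b = mono3 d" by (simp add: monom3_eq_mono3)
  have "mono3 d x = (\<Sum>a | int (mdeg a) \<le> int n. (if a = b then 1 else 0) * monom3 a x)" for x
  proof -
    have "(\<Sum>a | int (mdeg a) \<le> int n. (if a = b then 1 else 0) * monom3 a x)
        = (\<Sum>a | int (mdeg a) \<le> int n. if a = b then monom3 a x else 0)"
      by (rule sum.cong) auto
    then show ?thesis using finite_mdeg_le[of "int n"] b m by simp
  qed
  then have "mono3 d = (\<lambda>x. \<Sum>a | int (mdeg a) \<le> int n. (if a = b then 1 else 0) * monom3 a x)"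
    by (intro ext)
  then show ?thesis unfolding poly3_def
    by (intro CollectI exI[of _ "\<lambda>a. if a = b then 1 else 0"])
qed

text \<open>Multiplication by the coordinate sum, which is 1 on the triangle, raises the degree by
  one without changing values. The induction therefore runs downwards from \<open>N\<close>.\<close>

lemma mono3_homogenize:
  assumes "n \<le> N" "d \<in> multideg n"
  shows "\<exists>h. \<forall>x. in_T x \<longrightarrow> mono3 d x = (\<Sum>e\<in>multideg N. h e * mono3 e x)"
  using assms
proof (induction n arbitrary: d rule: inc_induct)
  case base
  have "mono3 d x = (\<Sum>e\<in>multideg N. (if e = d then 1 else 0) * mono3 e x)" for x
  proof -
    have "(\<Sum>e\<in>multideg N. (if e = d then 1 else 0) * mono3 e x) = (\<Sum>e\<in>multideg N. if e = d then mono3 e x else 0)"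
      by (rule sum.cong) auto
    then show ?thesis using base finite_multideg by simp
  qed
  then show ?case by (intro exI[of _ "\<lambda>e. if e = d then 1 else 0"]) simp
next
  case (step n)
  have "d(k := d k + 1) \<in> multideg (Suc n)" if "k < 3" for k
    using less_3_cases[OF that] step.prems by (auto simp: multideg_def)
  then have "\<forall>k<3. \<exists>h. \<forall>x. in_T x \<longrightarrow> mono3 (d(k := d k + 1)) x = (\<Sum>e\<in>multideg N. h e * mono3 e x)"
    using step.IH by blast
  then obtain h where h: "\<And>k x. k < 3 \<Longrightarrow> in_T x \<Longrightarrow> mono3 (d(k := d k + 1)) x = (\<Sum>e\<in>multideg N. h k e * mono3 e x)"
    by metis
  have "mono3 d x = (\<Sum>e\<in>multideg N. (h 0 e + h 1 e + h 2 e) * mono3 e x)" if T: "in_T x" for x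
  proof -
    have "mono3 d x = mono3 d x * (x 0 + x 1 + x 2)" using T by (simp add: in_T_def)
    also have "\<dots> = mono3 (d(0 := d 0 + 1)) x + mono3 (d(1 := d 1 + 1)) x + mono3 (d(2 := d 2 + 1)) x"
      by (simp add: mono3_def algebra_simps)
    also have "\<dots> = (\<Sum>e\<in>multideg N. h 0 e * mono3 e x) + (\<Sum>e\<in>multideg N. h 1 e * mono3 e x) + (\<Sum>e\<in>multideg N. h 2 e * mono3 e x)"
      using h[OF _ T] by simp
    finally show ?thesis by (simp add: distrib_right sum.distrib)
  qed
  then show ?case by (intro exI[of _ "\<lambda>e. h 0 e + h 1 e + h 2 e"]) simp
qed

lemma poly3_homogenize:
  assumes "p \<in> poly3 (int N)"
  shows "\<exists>h. \<forall>x. in_T x \<longrightarrow> p x = (\<Sum>e\<in>multideg N. h e * mono3 e x)"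
proof -
  obtain c where c: "p = (\<lambda>x. \<Sum>a\<in>{a. int (mdeg a) \<le> int N}. c a * monom3 a x)"
    using assms unfolding poly3_def by blast
  have "\<forall>a\<in>{a. int (mdeg a) \<le> int N}. \<exists>h. \<forall>x. in_T x \<longrightarrow> monom3 a x = (\<Sum>e\<in>multideg N. h e * mono3 e x)"
    unfolding monom3_eq_mono3 using mono3_homogenize[OF _ triple_deg_in_multideg] by auto
  then obtain h where h: "\<And>a x. int (mdeg a) \<le> int N \<Longrightarrow> in_T x \<Longrightarrow> monom3 a x = (\<Sum>e\<in>multideg N. h a e * mono3 e x)"
    unfolding bchoice_iff by blast
  have "p x = (\<Sum>e\<in>multideg N. (\<Sum>a | int (mdeg a) \<le> int N. c a * h a e) * mono3 e x)" if T: "in_T x" for x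
  proof -
    have "p x = (\<Sum>a | int (mdeg a) \<le> int N. c a * (\<Sum>e\<in>multideg N. h a e * mono3 e x))"
      unfolding c by (rule sum.cong) (simp_all add: h[OF _ T])
    also have "\<dots> = (\<Sum>a | int (mdeg a) \<le> int N. \<Sum>e\<in>multideg N. c a * h a e * mono3 e x)"
      by (simp add: sum_distrib_left mult.assoc)
    also have "\<dots> = (\<Sum>e\<in>multideg N. \<Sum>a | int (mdeg a) \<le> int N. c a * h a e * mono3 e x)"
      by (rule sum.swap)
    finally show ?thesis by (simp add: sum_distrib_right)
  qed
  then show ?thesis by (intro exI[of _ "\<lambda>e. \<Sum>a | int (mdeg a) \<le> int N. c a * h a e"]) simp
qed

section \<open>The two families of forms\<close>

definition dform :: "(nat \<Rightarrow> nat) \<times> nat \<Rightarrow> form1" where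
  "dform i x v = (if in_T x \<and> tangentT v then mono3 (fst i) x * v (snd i) else 0)"

text \<open>The Whitney form of the edge opposite vertex k: the contraction with X of the wedge
  product of the differentials of coordinates k + 1 and k + 2, taken in this cyclic order.\<close>

definition whitney :: "nat \<Rightarrow> pt \<Rightarrow> pt \<Rightarrow> real" where
  "whitney k x v = x (rot k) * v (rot (rot k)) - x (rot (rot k)) * v (rot k)"

text \<open>Removes from the multidegree what \<open>whitney k\<close> contributes, one at each
  index other than k, and leaves the exponents of the coefficient. The subtraction truncates exactly
  at the indices outside \<open>edge_idx\<close>.\<close>

definition lower :: "(nat \<Rightarrow> nat) \<Rightarrow> nat \<Rightarrow> nat \<Rightarrow> nat" where
  "lower d k i = (if i = k \<or> i \<ge> 3 then d i else d i - 1)"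

text \<open>Formally \<open>\<lambda>\<^sup>d (d\<lambda>\<^bsub>k+2\<^esub> / \<lambda>\<^bsub>k+2\<^esub> - d\<lambda>\<^bsub>k+1\<^esub> / \<lambda>\<^bsub>k+1\<^esub>)\<close>, indices modulo 3. Indexing by the
  multidegree \<open>d\<close> of the form, which counts \<open>d\<lambda>\<^sub>i\<close> like \<open>\<lambda>\<^sub>i\<close>, makes the only relation \<open>\<Sum>\<^sub>k wform (d, k) = 0\<close>.\<close>
definition wform :: "(nat \<Rightarrow> nat) \<times> nat \<Rightarrow> form1" where
  "wform i x v = (if in_T x \<and> tangentT v then mono3 (lower (fst i) (snd i)) x * whitney (snd i) x v else 0)"

definition all_idx :: "nat \<Rightarrow> ((nat \<Rightarrow> nat) \<times> nat) set" where
  "all_idx N = multideg N \<times> {..<3}"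

text \<open>It has two uses. For \<open>wform\<close> the condition says that \<open>lower\<close>
  does not truncate. For \<open>dform\<close> it gives zero trace: on edge i the form dies through
  its monomial if i differs from k, and through its differential if i = k.\<close>

definition edge_idx :: "nat \<Rightarrow> ((nat \<Rightarrow> nat) \<times> nat) set" where
  "edge_idx N = {(d, k) \<in> all_idx N. \<forall>i<3. i \<noteq> k \<longrightarrow> 1 \<le> d i}"

text \<open>For \<open>wform\<close> the trace on the edges other than k vanishes by the Whitney
  factor alone; a positive exponent at k takes care of edge k.\<close>

definition interior_idx :: "nat \<Rightarrow> ((nat \<Rightarrow> nat) \<times> nat) set" where
  "interior_idx N = {(d, k) \<in> all_idx N. \<forall>i<3. 1 \<le> d i}"

lemma finite_all_idx: "finite (all_idx N)"
  by (simp add: all_idx_def finite_multideg)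

lemma edge_idx_sub: "edge_idx N \<subseteq> all_idx N"
  by (auto simp: edge_idx_def)

lemma interior_idx_sub: "interior_idx N \<subseteq> edge_idx N"
  by (auto simp: edge_idx_def interior_idx_def)

lemma finite_edge_idx: "finite (edge_idx N)"
  by (rule finite_subset[OF edge_idx_sub finite_all_idx])

lemma all_less_3_perm:
  assumes "\<pi> permutes {..<3}"
  shows "(\<forall>i<3. P (\<pi> i)) \<longleftrightarrow> (\<forall>i<3::nat. P i)"
proof
  assume *: "\<forall>i<3. P (\<pi> i)"
  show "\<forall>i<3. P i"
  proof (intro allI impI)
    fix i :: nat assume "i < 3"
    moreover have "\<pi> (inv \<pi> i) = i" using assms by (simp add: permutes_inverses)
    ultimately show "P i" using * perm_less_3[OF assms, of "inv \<pi> i"] by metis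
  qed
qed (use perm_less_3[OF assms] in blast)

lemma all_idx_perm: "\<pi> permutes {..<3} \<Longrightarrow> k < 3 \<Longrightarrow> (d \<circ> \<pi>, k) \<in> all_idx N \<longleftrightarrow> (d, \<pi> k) \<in> all_idx N"
  using multideg_comp perm_less_3 by (auto simp: all_idx_def)

lemma edge_idx_perm:
  assumes "\<pi> permutes {..<3}" "k < 3"
  shows "(d \<circ> \<pi>, k) \<in> edge_idx N \<longleftrightarrow> (d, \<pi> k) \<in> edge_idx N"
proof -
  have "\<pi> i = \<pi> k \<longleftrightarrow> i = k" for i using permutes_inj[OF assms(1)] by (auto simp: inj_eq)
  then have "(\<forall>i<3. i \<noteq> k \<longrightarrow> 1 \<le> d (\<pi> i)) \<longleftrightarrow> (\<forall>i<3. i \<noteq> \<pi> k \<longrightarrow> 1 \<le> d i)"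
    using all_less_3_perm[OF assms(1), of "\<lambda>i. i \<noteq> \<pi> k \<longrightarrow> 1 \<le> d i"] by simp
  then show ?thesis using all_idx_perm[OF assms, of d N] by (auto simp: edge_idx_def)
qed

lemma interior_idx_perm:
  assumes "\<pi> permutes {..<3}" "k < 3"
  shows "(d \<circ> \<pi>, k) \<in> interior_idx N \<longleftrightarrow> (d, \<pi> k) \<in> interior_idx N"
  using all_less_3_perm[OF assms(1), of "\<lambda>i. 1 \<le> d i"] all_idx_perm[OF assms, of d N]
  by (auto simp: interior_idx_def)

lemma all_idx_fill: "(d, j) \<in> all_idx N \<Longrightarrow> (d, k) \<in> all_idx N \<Longrightarrow> j \<noteq> k \<Longrightarrow> l < 3 \<Longrightarrow> (d, l) \<in> all_idx N"
  by (auto simp: all_idx_def)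

text \<open>Every index differs from j or from k, so two distinct indices at \<open>d\<close> force
  all exponents to be positive.\<close>

lemma edge_idx_fill: "(d, j) \<in> edge_idx N \<Longrightarrow> (d, k) \<in> edge_idx N \<Longrightarrow> j \<noteq> k \<Longrightarrow> l < 3 \<Longrightarrow> (d, l) \<in> edge_idx N"
  by (fastforce simp: edge_idx_def all_idx_def)

lemma interior_idx_fill:
  "(d, j) \<in> interior_idx N \<Longrightarrow> (d, k) \<in> interior_idx N \<Longrightarrow> j \<noteq> k \<Longrightarrow> l < 3 \<Longrightarrow> (d, l) \<in> interior_idx N"
  by (auto simp: interior_idx_def all_idx_def)

lemma sum_all_idx_rot:
  assumes "j < 3"
  shows "(\<Sum>i\<in>all_idx N. f i) = (\<Sum>d\<in>multideg N. f (d, j)) + (\<Sum>d\<in>multideg N. f (d, rot j)) + (\<Sum>d\<in>multideg N. f (d, rot (rot j)) :: real)"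
proof -
  have "(\<Sum>i\<in>all_idx N. f i) = (\<Sum>d\<in>multideg N. \<Sum>k<3. f (d, k))"
    unfolding all_idx_def by (simp add: sum.cartesian_product)
  also have "\<dots> = (\<Sum>d\<in>multideg N. f (d, j) + f (d, rot j) + f (d, rot (rot j)))"
    using sum_rot[OF assms, of "\<lambda>k. f (_, k)"] by (intro sum.cong refl) (simp add: sum_less_3)
  finally show ?thesis by (simp add: sum.distrib)
qed

lemma sum_idx_extend:
  assumes "I \<subseteq> all_idx N" "\<And>i. i \<notin> I \<Longrightarrow> c i = (0::real)"
  shows "(\<Sum>i\<in>I. c i * f i) = (\<Sum>i\<in>all_idx N. c i * f i)"
  by (rule sum.mono_neutral_left[OF finite_all_idx assms(1)]) (use assms(2) in auto)

section \<open>Relations among the forms \<open>dform\<close>\<close>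

definition edge_vec :: "nat \<Rightarrow> nat \<Rightarrow> pt" where
  "edge_vec i j k = (if k = i then 1 else 0) - (if k = j then 1 else 0)"

lemma tangentT_edge_vec: "i < 3 \<Longrightarrow> j < 3 \<Longrightarrow> tangentT (edge_vec i j)"
  by (auto simp: tangentT_def edge_vec_def dest!: less_3_cases)

text \<open>Evaluation on the tangent vector of an edge leaves the difference of two coefficients.
  Such differences are all that can be recovered, since the three differentials have sum zero on the
  triangle.\<close>

lemma dform_sum_edge_vec:
  assumes "in_T x" "i < 3"
  shows "(\<Sum>p\<in>all_idx N. c p * dform p x (edge_vec (rot i) (rot (rot i))))
    = (\<Sum>d\<in>multideg N. (c (d, rot i) - c (d, rot (rot i))) * mono3 d x)"
  using assms tangentT_edge_vec[of "rot i" "rot (rot i)"] rot_neq[OF assms(2)]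
  by (simp add: sum_all_idx_rot[OF assms(2)] dform_def edge_vec_def left_diff_distrib sum_subtractf sum_negf)

lemma dform_indep:
  assumes "\<And>x v. (\<Sum>p\<in>all_idx N. c p * dform p x v) = 0" "d \<in> multideg N" "j < 3" "k < 3"
  shows "c (d, j) = c (d, k)"
proof -
  have eq: "c (d, rot i) = c (d, rot (rot i))" if "i < 3" for i
  proof -
    have "c (d, rot i) - c (d, rot (rot i)) = 0"
      by (rule mono3_indep[where N = N and a = "\<lambda>d. c (d, rot i) - c (d, rot (rot i))", OF _ assms(2)])
        (subst dform_sum_edge_vec[OF _ that, symmetric], assumption, rule assms(1))
    then show ?thesis by simp
  qed
  from eq[of 0] eq[of 1] eq[of 2] show ?thesis
    using less_3_cases[OF assms(3)] less_3_cases[OF assms(4)] by auto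
qed

text \<open>The sign is 1: a monomial times one differential carries no orientation, so even and odd
  permutations act by the same formula.\<close>

lemma S3_family_dform:
  assumes sub: "I \<subseteq> all_idx N"
    and fill: "\<And>d j k l. (d, j) \<in> I \<Longrightarrow> (d, k) \<in> I \<Longrightarrow> j \<noteq> k \<Longrightarrow> l < 3 \<Longrightarrow> (d, l) \<in> I"
    and perm: "\<And>\<pi> d k. \<pi> permutes {..<3} \<Longrightarrow> k < 3 \<Longrightarrow> (d \<circ> \<pi>, k) \<in> I \<longleftrightarrow> (d, \<pi> k) \<in> I"
  shows "S3_family N I dform 1"
proof
  show "I \<subseteq> multideg N \<times> {..<3}" using sub by (simp add: all_idx_def)
next
  fix \<pi> d :: "nat \<Rightarrow> nat" and k :: nat assume \<pi>: "\<pi> permutes {..<3}"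
  have act: "S3act \<pi> (dform (d \<circ> \<pi>, k)) = dform (d, \<pi> k)"
    by (intro ext) (simp add: S3act_def dform_def in_T_perm[OF \<pi>] tangentT_perm[OF \<pi>] mono3_perm[OF \<pi>])
  show "S3act \<pi> (dform (d \<circ> \<pi>, k)) = dform (d, \<pi> k)"
    "S3act \<pi> (dform (d \<circ> \<pi>, k)) = (\<lambda>x v. 1 * dform (d, \<pi> k) x v)"
    unfolding act by simp_all
next
  fix d x v
  show "dform (d, 0) x v + dform (d, 1) x v + dform (d, 2) x v = 0"
  proof (cases "in_T x \<and> tangentT v")
    case True
    have "mono3 d x * v 0 + mono3 d x * v 1 + mono3 d x * v 2 = mono3 d x * (v 0 + v 1 + v 2)"
      by (simp add: distrib_left)
    also have "\<dots> = 0" using True by (simp add: tangentT_def)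
    finally show ?thesis using True by (simp add: dform_def)
  qed (auto simp: dform_def)
next
  fix c :: "(nat \<Rightarrow> nat) \<times> nat \<Rightarrow> real" and j k :: nat and d
  assume z: "\<And>x v. (\<Sum>i\<in>I. c i * dform i x v) = 0" and c: "\<And>i. i \<notin> I \<Longrightarrow> c i = 0" and jk: "j < 3" "k < 3"
  show "c (d, j) = c (d, k)"
  proof (cases "d \<in> multideg N")
    case True
    have "(\<Sum>i\<in>all_idx N. c i * dform i x v) = 0" for x v
      using z[of x v] sum_idx_extend[OF sub c] by simp
    then show ?thesis by (intro dform_indep[of c N d j k] True jk)
  next
    case False
    then have "(d, j) \<notin> I" "(d, k) \<notin> I" using sub by (auto simp: all_idx_def)
    then show ?thesis using c by simp
  qed
next
  show "(d, l) \<in> I" if "(d, j) \<in> I" "(d, k) \<in> I" "j \<noteq> k" "l < 3" for d j k l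
    by (rule fill[OF that])
next
  show "(d \<circ> \<pi>, k) \<in> I \<longleftrightarrow> (d, \<pi> k) \<in> I" if "\<pi> permutes {..<3}" "k < 3" for \<pi> d k
    by (rule perm[OF that])
qed simp

section \<open>Relations among the forms \<open>wform\<close>\<close>

lemma lower_perm:
  assumes "\<pi> permutes {..<3}"
  shows "lower (d \<circ> \<pi>) k = lower d (\<pi> k) \<circ> \<pi>"
proof -
  have "\<pi> i = \<pi> k \<longleftrightarrow> i = k" for i using permutes_inj[OF assms] by (auto simp: inj_eq)
  then show ?thesis using perm_less_3[OF assms] by (auto simp: fun_eq_iff lower_def not_less[symmetric])
qed

text \<open>Clears the denominators in the formal expression for \<open>wform\<close>, so that all
  forms of one multidegree share the monomial \<open>mono3 d\<close>.\<close>

lemma mono3_lower: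
  assumes "(d, k) \<in> edge_idx N"
  shows "mono3 (lower d k) x * (x (rot k) * x (rot (rot k))) = mono3 d x"
proof -
  have k: "k < 3" using assms by (auto simp: edge_idx_def all_idx_def)
  have "1 \<le> d (rot k)" "1 \<le> d (rot (rot k))"
    using assms k rot_neq[OF k] by (auto simp: edge_idx_def)
  then obtain a b where "d (rot k) = Suc a" "d (rot (rot k)) = Suc b"
    by (metis Suc_le_D One_nat_def)
  moreover have "\<not> 3 \<le> rot k" "\<not> 3 \<le> rot (rot k)" using k by (simp_all add: not_le)
  ultimately show ?thesis using rot_neq[OF k] by (simp add: mono3_rot[OF k] lower_def)
qed

text \<open>Multiplied by all three coordinates, the relation says that the sum of
  \<open>g k x * x k * whitney k x v\<close> over k vanishes. At interior points this forces the
  three functions \<open>g k\<close> to agree, and independence of monomials passes this on to the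
  coefficients.\<close>

lemma wform_indep:
  assumes z: "\<And>x v. (\<Sum>p\<in>all_idx N. c p * wform p x v) = 0" and c: "\<And>i. i \<notin> edge_idx N \<Longrightarrow> c i = 0"
    and "d \<in> multideg N" "j < 3" "k < 3"
  shows "c (d, j) = c (d, k)"
proof -
  define g where "g k x = (\<Sum>d\<in>multideg N. c (d, k) * mono3 d x)" for k x
  have w: "(\<Sum>d\<in>multideg N. c (d, k) * wform (d, k) x v) * (x (rot k) * x (rot (rot k))) = g k x * whitney k x v"
    if "in_T x" "tangentT v" for k x v
  proof -
    have "c (d, k) * wform (d, k) x v * (x (rot k) * x (rot (rot k))) = c (d, k) * mono3 d x * whitney k x v" for d
    proof (cases "(d, k) \<in> edge_idx N")
      case True
      then show ?thesis using that mono3_lower[OF True, of x, symmetric] by (simp add: wform_def)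
    qed (use c in simp)
    then show ?thesis unfolding g_def sum_distrib_right by (intro sum.cong refl)
  qed
  have g: "g 0 x = g 1 x \<and> g 1 x = g 2 x" if T: "in_T x" and pos: "\<And>i. i < 3 \<Longrightarrow> x i > 0" for x
  proof -
    have x: "x 0 > 0" "x 1 > 0" "x 2 > 0" using pos by simp_all
    have sum: "g 0 x * whitney 0 x v * x 0 + g 1 x * whitney 1 x v * x 1 + g 2 x * whitney 2 x v * x 2 = 0"
      if v: "tangentT v" for v
    proof -
      let ?W = "\<lambda>k. (\<Sum>d\<in>multideg N. c (d, k) * wform (d, k) x v)"
      have "?W 0 + ?W 1 + ?W 2 = 0"
        using z[of x v] sum_all_idx_rot[of 0 "\<lambda>p. c p * wform p x v" N] by simp
      then have "0 = (?W 0 + ?W 1 + ?W 2) * (x 0 * x 1 * x 2)" by (simp only: mult_zero_left)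
      also have "\<dots> = ?W 0 * (x 1 * x 2) * x 0 + ?W 1 * (x 2 * x 0) * x 1 + ?W 2 * (x 0 * x 1) * x 2"
        by (simp only: algebra_simps)
      also have "?W 0 * (x 1 * x 2) = g 0 x * whitney 0 x v" using w[OF T v, of 0] by simp
      also have "?W 1 * (x 2 * x 0) = g 1 x * whitney 1 x v" using w[OF T v, of 1] by simp
      also have "?W 2 * (x 0 * x 1) = g 2 x * whitney 2 x v" using w[OF T v, of 2] by simp
      finally show ?thesis by (rule sym)
    qed
    \<comment> \<open>The coefficient of \<open>v k\<close> in the sum is the product of the other
      two coordinates with P_k. Vanishing on tangent vectors makes the vector P proportional to x;
      but P has coordinate sum 0 and x has coordinate sum 1, so P = 0.\<close>
    define P0 P1 P2 where P: "P0 = g 1 x - g 2 x" "P1 = g 2 x - g 0 x" "P2 = g 0 x - g 1 x"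
    have "x 2 * (P1 * x 0 - P0 * x 1) = 0"
      using sum[OF tangentT_edge_vec[of 1 0]] by (simp add: whitney_def edge_vec_def P algebra_simps)
    then have 1: "P1 * x 0 = P0 * x 1" using x by simp
    have "x 1 * (P2 * x 0 - P0 * x 2) = 0"
      using sum[OF tangentT_edge_vec[of 2 0]] by (simp add: whitney_def edge_vec_def P algebra_simps)
    then have 2: "P2 * x 0 = P0 * x 2" using x by simp
    have "x 0 + x 1 + x 2 = 1" using T by (simp add: in_T_def)
    then have "P0 = P0 * x 0 + P0 * x 1 + P0 * x 2" by (simp flip: distrib_left)
    also have "\<dots> = (P0 + P1 + P2) * x 0" unfolding 1[symmetric] 2[symmetric] by (simp add: algebra_simps)
    also have "\<dots> = 0" by (simp add: P)
    finally have "P0 = 0" .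
    then have "P1 = 0" using 1 x by simp
    then show ?thesis using \<open>P0 = 0\<close> by (simp add: P)
  qed
  have "c (d, 0) - c (d, 1) = 0"
    by (rule mono3_indep[where N = N and a = "\<lambda>d. c (d, 0) - c (d, 1)", OF _ assms(3)])
      (use g in \<open>simp add: g_def left_diff_distrib sum_subtractf\<close>)
  moreover have "c (d, 1) - c (d, 2) = 0"
    by (rule mono3_indep[where N = N and a = "\<lambda>d. c (d, 1) - c (d, 2)", OF _ assms(3)])
      (use g in \<open>simp add: g_def left_diff_distrib sum_subtractf\<close>)
  ultimately show ?thesis
    using less_3_cases[OF assms(4)] less_3_cases[OF assms(5)] by auto
qed

lemma whitney_even:
  assumes "\<forall>k<3. \<pi> (rot k) = rot (\<pi> k)" "k < 3"
  shows "whitney k (x \<circ> \<pi>) (v \<circ> \<pi>) = whitney (\<pi> k) x v"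
  using assms by (simp add: whitney_def)

lemma whitney_odd:
  assumes "\<forall>k<3. \<pi> (rot k) = rot (rot (\<pi> k))" "k < 3"
  shows "whitney k (x \<circ> \<pi>) (v \<circ> \<pi>) = - whitney (\<pi> k) x v"
  using assms by (simp add: whitney_def)

text \<open>The sign is -1: reversing the cyclic order exchanges the two terms of
  \<open>whitney\<close>.\<close>

lemma S3_family_wform:
  assumes sub: "I \<subseteq> edge_idx N"
    and fill: "\<And>d j k l. (d, j) \<in> I \<Longrightarrow> (d, k) \<in> I \<Longrightarrow> j \<noteq> k \<Longrightarrow> l < 3 \<Longrightarrow> (d, l) \<in> I"
    and perm: "\<And>\<pi> d k. \<pi> permutes {..<3} \<Longrightarrow> k < 3 \<Longrightarrow> (d \<circ> \<pi>, k) \<in> I \<longleftrightarrow> (d, \<pi> k) \<in> I"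
  shows "S3_family N I wform (-1)"
proof
  show "I \<subseteq> multideg N \<times> {..<3}" using sub edge_idx_sub by (auto simp: all_idx_def)
next
  fix \<pi> d :: "nat \<Rightarrow> nat" and k :: nat assume \<pi>: "\<pi> permutes {..<3}" and k: "k < 3"
  note T = in_T_perm[OF \<pi>] tangentT_perm[OF \<pi>]
  have m: "mono3 (lower (d \<circ> \<pi>) k) (x \<circ> \<pi>) = mono3 (lower d (\<pi> k)) x" for x
    by (simp add: lower_perm[OF \<pi>] mono3_perm[OF \<pi>])
  show "S3act \<pi> (wform (d \<circ> \<pi>, k)) = wform (d, \<pi> k)" if "\<forall>k<3. \<pi> (rot k) = rot (\<pi> k)"
    by (intro ext) (simp add: S3act_def wform_def T m whitney_even[OF that k])
  show "S3act \<pi> (wform (d \<circ> \<pi>, k)) = (\<lambda>x v. -1 * wform (d, \<pi> k) x v)" if "\<forall>k<3. \<pi> (rot k) = rot (rot (\<pi> k))"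
    by (intro ext) (simp add: S3act_def wform_def T m whitney_odd[OF that k])
next
  fix d x v assume "\<And>k. k < 3 \<Longrightarrow> (d, k) \<in> I"
  then have e: "(d, 0) \<in> edge_idx N" "(d, 1) \<in> edge_idx N" using sub by auto
  then have "1 \<le> d 0" "1 \<le> d 1" "1 \<le> d 2" by (auto simp: edge_idx_def)
  then obtain a b c where "d 0 = Suc a" "d (Suc 0) = Suc b" "d 2 = Suc c"
    by (metis Suc_le_D One_nat_def)
  \<comment> \<open>After the common factor with exponents a, b, c is taken out, the sum of
    \<open>x k * whitney k x v\<close> remains. It is the volume form contracted twice with X, hence
    zero.\<close>
  then show "wform (d, 0) x v + wform (d, 1) x v + wform (d, 2) x v = 0"
    by (simp add: wform_def mono3_def lower_def whitney_def algebra_simps)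
next
  fix c :: "(nat \<Rightarrow> nat) \<times> nat \<Rightarrow> real" and j k :: nat and d
  assume z: "\<And>x v. (\<Sum>i\<in>I. c i * wform i x v) = 0" and c: "\<And>i. i \<notin> I \<Longrightarrow> c i = 0" and jk: "j < 3" "k < 3"
  have sub': "I \<subseteq> all_idx N" using sub edge_idx_sub by blast
  have c': "c i = 0" if "i \<notin> edge_idx N" for i using that sub c by blast
  have z': "(\<Sum>i\<in>all_idx N. c i * wform i x v) = 0" for x v
    using z[of x v] sum_idx_extend[OF sub' c] by simp
  show "c (d, j) = c (d, k)"
  proof (cases "d \<in> multideg N")
    case True
    then show ?thesis by (intro wform_indep[of c N d j k] z' c' jk)
  next
    case False
    then have "(d, j) \<notin> I" "(d, k) \<notin> I" using sub' by (auto simp: all_idx_def)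
    then show ?thesis using c by simp
  qed
next
  show "(d, l) \<in> I" if "(d, j) \<in> I" "(d, k) \<in> I" "j \<noteq> k" "l < 3" for d j k l
    by (rule fill[OF that])
next
  show "(d \<circ> \<pi>, k) \<in> I \<longleftrightarrow> (d, \<pi> k) \<in> I" if "\<pi> permutes {..<3}" "k < 3" for \<pi> d k
    by (rule perm[OF that])
qed simp

section \<open>The four polynomial spaces as spans\<close>

lemma form_span_least:
  assumes zero: "(\<lambda>x v. 0) \<in> V"
    and add: "\<And>F G. F \<in> V \<Longrightarrow> G \<in> V \<Longrightarrow> (\<lambda>x v. F x v + G x v) \<in> V"
    and scale: "\<And>a F. F \<in> V \<Longrightarrow> (\<lambda>x v. a * F x v) \<in> V"
    and base: "\<And>i. i \<in> A \<Longrightarrow> u i \<in> V"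
  shows "form_span A u \<subseteq> V"
proof
  fix F assume "F \<in> form_span A u"
  then obtain c where F: "F = (\<lambda>x v. \<Sum>i\<in>A. c i * u i x v)" unfolding form_span_def by blast
  show "F \<in> V" unfolding F using base
  proof (induction A rule: infinite_finite_induct)
    case (insert i A)
    then have "(\<lambda>x v. c i * u i x v + (\<Sum>i\<in>A. c i * u i x v)) \<in> V"
      by (intro add scale) auto
    then show ?case using insert.hyps by simp
  qed (use zero in simp_all)
qed

lemma trT_add: "(\<lambda>x v. trT p x v + trT q x v) = trT (\<lambda>k x. p k x + q k x)"
  by (intro ext) (simp add: trT_def distrib_right sum.distrib)

lemma trT_scale: "(\<lambda>x v. a * trT p x v) = trT (\<lambda>k x. a * p k x)"
  by (intro ext) (simp add: trT_def sum_distrib_left mult.assoc)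

lemma trT_zero: "trT (\<lambda>k x. 0) = (\<lambda>x v. 0)"
  by (intro ext) (simp add: trT_def)

lemma PL1_eq_span: "PL1 r = form_span (all_idx r) dform"
proof
  show "form_span (all_idx r) dform \<subseteq> PL1 r"
  proof (rule form_span_least)
    show "(\<lambda>x v. 0) \<in> PL1 r"
      unfolding PL1_def trT_zero[symmetric] using poly3_zero by blast
  next
    fix F G assume "F \<in> PL1 r" "G \<in> PL1 r"
    then obtain p q where "F = trT p" "G = trT q" "\<forall>k<3. p k \<in> poly3 (int r)" "\<forall>k<3. q k \<in> poly3 (int r)"
      unfolding PL1_def by blast
    then show "(\<lambda>x v. F x v + G x v) \<in> PL1 r"
      unfolding PL1_def by (auto simp: trT_add intro!: exI[of _ "\<lambda>k x. p k x + q k x"] poly3_add)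
  next
    fix a F assume "F \<in> PL1 r"
    then obtain p where "F = trT p" "\<forall>k<3. p k \<in> poly3 (int r)"
      unfolding PL1_def by blast
    then show "(\<lambda>x v. a * F x v) \<in> PL1 r"
      unfolding PL1_def by (auto simp: trT_scale intro!: exI[of _ "\<lambda>k x. a * p k x"] poly3_scale)
  next
    fix i assume "i \<in> all_idx r"
    then obtain d k where i: "i = (d, k)" "d \<in> multideg r" "k < 3" by (auto simp: all_idx_def)
    define p where "p j x = (if j = k then mono3 d x else 0)" for j x
    have "(\<Sum>j<3. p j x * v j) = mono3 d x * v k" for x v
      using less_3_cases[OF i(3)] by (auto simp: p_def sum_less_3)
    then have "dform i = trT p" by (intro ext) (simp add: dform_def trT_def i(1))
    moreover have "p j = (if j = k then mono3 d else (\<lambda>x. 0))" for j by (auto simp: p_def)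
    then have "p j \<in> poly3 (int r)" for j using mono3_in_poly3[OF i(2)] poly3_zero by simp
    ultimately show "dform i \<in> PL1 r" unfolding PL1_def by blast
  qed
  show "PL1 r \<subseteq> form_span (all_idx r) dform"
  proof
    fix F assume "F \<in> PL1 r"
    then obtain p where F: "F = trT p" and p: "\<forall>k<3. p k \<in> poly3 (int r)"
      unfolding PL1_def by blast
    have "\<exists>h. \<forall>x. in_T x \<longrightarrow> p k x = (\<Sum>e\<in>multideg r. h e * mono3 e x)" if "k < 3" for k
      using poly3_homogenize p that by blast
    then obtain h where h: "\<And>k x. k < 3 \<Longrightarrow> in_T x \<Longrightarrow> p k x = (\<Sum>e\<in>multideg r. h k e * mono3 e x)"
      by metis
    have "F x v = (\<Sum>i\<in>all_idx r. h (snd i) (fst i) * dform i x v)" for x v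
    proof (cases "in_T x \<and> tangentT v")
      case True
      then have "F x v = (\<Sum>k<3. (\<Sum>e\<in>multideg r. h k e * mono3 e x) * v k)"
        unfolding F trT_def by (auto intro!: sum.cong simp: h)
      also have "\<dots> = (\<Sum>k<3. \<Sum>e\<in>multideg r. h k e * dform (e, k) x v)"
        using True by (simp add: dform_def sum_distrib_right mult.assoc)
      finally show ?thesis by (simp add: sum_less_3 sum_all_idx_rot[of 0])
    qed (auto simp: F trT_def dform_def)
    then show "F \<in> form_span (all_idx r) dform" by (rule form_spanI)
  qed
qed

text \<open>Zero trace on an edge i with \<open>d i = 0\<close> only forces the coefficients of the
  other two indices to agree, not to vanish. A multiple of the relation at \<open>d\<close> is then
  subtracted to move the expansion into \<open>edge_idx\<close>.\<close>

lemma PL1_0_eq_span: "PL1_0 r = form_span (edge_idx r) dform"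
proof
  show "form_span (edge_idx r) dform \<subseteq> PL1_0 r"
  proof
    fix F assume F: "F \<in> form_span (edge_idx r) dform"
    have "form_span (edge_idx r) dform \<subseteq> form_span (all_idx r) dform"
      by (rule form_span_mono, rule form_span_base[OF finite_all_idx]) (use edge_idx_sub in auto)
    then have "F \<in> PL1 r" using F by (auto simp: PL1_eq_span)
    moreover obtain c where c: "\<And>x v. F x v = (\<Sum>i\<in>edge_idx r. c i * dform i x v)"
      using F unfolding form_span_iff by blast
    have "dform p x v = 0" if "p \<in> edge_idx r" "i < 3" "x i = 0" "v i = 0" for p i x v
    proof (cases "i = snd p")
      case False
      then have "1 \<le> fst p i" using that by (cases p) (auto simp: edge_idx_def)
      then have "mono3 (fst p) x = 0" using that by (simp add: mono3_rot[OF that(2)])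
      then show ?thesis by (simp add: dform_def)
    qed (use that in \<open>simp add: dform_def\<close>)
    then have "zero_trace F" unfolding zero_trace_def c by (auto intro!: sum.neutral)
    ultimately show "F \<in> PL1_0 r" by (simp add: PL1_0_def)
  qed
  show "PL1_0 r \<subseteq> form_span (edge_idx r) dform"
  proof
    fix F assume F: "F \<in> PL1_0 r"
    then have "F \<in> form_span (all_idx r) dform" by (simp add: PL1_0_def PL1_eq_span)
    then obtain c where c: "\<And>x v. F x v = (\<Sum>i\<in>all_idx r. c i * dform i x v)"
      unfolding form_span_iff by blast
    have eq: "c (d, rot i) = c (d, rot (rot i))" if i: "i < 3" and d: "d \<in> multideg r" "d i = 0" for d i
    proof -
      have "c (d, rot i) - c (d, rot (rot i)) = 0"
      proof (rule mono3_indep_edge[where N = r and a = "\<lambda>d. c (d, rot i) - c (d, rot (rot i))", OF i _ d])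
        fix x assume x: "in_T x" "x i = 0"
        have "edge_vec (rot i) (rot (rot i)) i = 0" using rot_neq[OF i] by (simp add: edge_vec_def)
        then have "F x (edge_vec (rot i) (rot (rot i))) = 0"
          using F x i tangentT_edge_vec[of "rot i" "rot (rot i)"] by (simp add: PL1_0_def zero_trace_def)
        then show "(\<Sum>d\<in>multideg r. (c (d, rot i) - c (d, rot (rot i))) * mono3 d x) = 0"
          unfolding c dform_sum_edge_vec[OF x(1) i] .
      qed
      then show ?thesis by simp
    qed
    \<comment> \<open>The common value of the two coefficients next to some vanishing exponent. The
      later argument shows that any choice among several vanishing exponents works.\<close>
    define m where "m d = (if \<exists>i<3. d i = 0 then c (d, rot (SOME i. i < 3 \<and> d i = 0)) else 0)" for d
    define c' where "c' p = c p - m (fst p)" for p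
    have c'0: "c' (d, k) = 0" if dk: "(d, k) \<in> all_idx r" "(d, k) \<notin> edge_idx r" for d k
    proof -
      have k: "k < 3" and d: "d \<in> multideg r" using dk by (auto simp: all_idx_def)
      obtain i where i: "i < 3" "i \<noteq> k" "d i = 0" using dk by (auto simp: edge_idx_def)
      define l where "l = (SOME i. i < 3 \<and> d i = 0)"
      have l: "l < 3" "d l = 0" using someI[of "\<lambda>i. i < 3 \<and> d i = 0" i] i by (simp_all add: l_def)
      have m: "m d = c (d, rot l)" using i by (auto simp: m_def l_def)
      have "c (d, k) = c (d, rot l)"
        using rot_cases[OF k l(1)]
      proof (elim disjE)
        assume "k = l"
        \<comment> \<open>Here k is the chosen vanishing exponent and i is another one; the
          equalities from both edges make all three coefficients at \<open>d\<close> equal.\<close>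
        then have "i = rot k \<or> i = rot (rot k)" using rot_cases[OF i(1) k] i(2) by blast
        then show ?thesis using eq[OF i(1) d i(3)] eq[OF l(1) d l(2)] \<open>k = l\<close> by auto
      qed (use eq[OF l(1) d l(2)] in auto)
      then show ?thesis by (simp add: c'_def m)
    qed
    have "F x v = (\<Sum>i\<in>edge_idx r. c' i * dform i x v)" for x v
    proof -
      \<comment> \<open>The subtracted part is a combination of the relations of the family, so
        \<open>F\<close> is unchanged.\<close>
      have "(\<Sum>i\<in>all_idx r. m (fst i) * dform i x v) = (\<Sum>d\<in>multideg r. m d * (dform (d, 0) x v + dform (d, 1) x v + dform (d, 2) x v))"
        by (simp add: sum_all_idx_rot[of 0] distrib_left sum.distrib)
      also have "\<dots> = 0"
      proof (rule sum.neutral, rule ballI)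
        interpret S3_family r "all_idx r" dform 1
          by (rule S3_family_dform[OF subset_refl all_idx_fill all_idx_perm])
        fix d assume "d \<in> multideg r"
        then show "m d * (dform (d, 0) x v + dform (d, 1) x v + dform (d, 2) x v) = 0"
          using rel[of d x v] by (simp add: all_idx_def)
      qed
      finally have "F x v = (\<Sum>i\<in>all_idx r. c' i * dform i x v)"
        by (simp add: c c'_def left_diff_distrib sum_subtractf)
      also have "\<dots> = (\<Sum>i\<in>edge_idx r. c' i * dform i x v)"
        by (rule sum.mono_neutral_right[OF finite_all_idx edge_idx_sub]) (use c'0 in auto)
      finally show ?thesis .
    qed
    then show "F \<in> form_span (edge_idx r) dform" by (rule form_spanI)
  qed
qed

text \<open>The middle sign is negative because \<open>whitney 1\<close> uses the cyclic order (2,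
  0), while the coefficient \<open>q 0 2\<close> belongs to the order (0, 2).\<close>

lemma trT_contrX:
  "trT (contrX q) x v = (if in_T x \<and> tangentT v
     then q 1 2 x * whitney 0 x v - q 0 2 x * whitney 1 x v + q 0 1 x * whitney 2 x v else 0)"
proof -
  have "{0<..<3} = {1, 2::nat}" "{1<..<3} = {2::nat}" "{2<..<3} = ({}::nat set)" by auto
  moreover have "{..<1} = {0::nat}" "{..<2} = {0, 1::nat}" by auto
  ultimately show ?thesis
    by (simp add: trT_def contrX_def sum_less_3 whitney_def algebra_simps)
qed

lemma PmL1_eq_span: "PmL1 r = form_span (edge_idx (r + 1)) wform"
proof
  show "form_span (edge_idx (r + 1)) wform \<subseteq> PmL1 r"
  proof (rule form_span_least)
    have "(\<lambda>x v. 0) = trT (contrX (\<lambda>i j x. 0))"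
      by (intro ext) (simp add: trT_contrX)
    then show "(\<lambda>x v. 0) \<in> PmL1 r"
      unfolding PmL1_def using poly3_zero by blast
  next
    fix F G assume "F \<in> PmL1 r" "G \<in> PmL1 r"
    then obtain p q where pq: "F = trT (contrX p)" "G = trT (contrX q)"
      "\<forall>i j. i < j \<and> j < 3 \<longrightarrow> p i j \<in> poly3 (int r - 1)" "\<forall>i j. i < j \<and> j < 3 \<longrightarrow> q i j \<in> poly3 (int r - 1)"
      unfolding PmL1_def by blast
    have "(\<lambda>x v. F x v + G x v) = trT (contrX (\<lambda>i j x. p i j x + q i j x))"
      by (intro ext) (simp add: pq trT_contrX algebra_simps)
    moreover have "\<forall>i j. i < j \<and> j < 3 \<longrightarrow> (\<lambda>x. p i j x + q i j x) \<in> poly3 (int r - 1)"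
      using pq poly3_add by blast
    ultimately show "(\<lambda>x v. F x v + G x v) \<in> PmL1 r" unfolding PmL1_def by blast
  next
    fix a F assume "F \<in> PmL1 r"
    then obtain p where p: "F = trT (contrX p)" "\<forall>i j. i < j \<and> j < 3 \<longrightarrow> p i j \<in> poly3 (int r - 1)"
      unfolding PmL1_def by blast
    have "(\<lambda>x v. a * F x v) = trT (contrX (\<lambda>i j x. a * p i j x))"
      by (intro ext) (simp add: p trT_contrX algebra_simps)
    moreover have "\<forall>i j. i < j \<and> j < 3 \<longrightarrow> (\<lambda>x. a * p i j x) \<in> poly3 (int r - 1)"
      using p poly3_scale by blast
    ultimately show "(\<lambda>x v. a * F x v) \<in> PmL1 r" unfolding PmL1_def by blast
  next
    fix p assume "p \<in> edge_idx (r + 1)"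
    then obtain d k where dk: "p = (d, k)" "d \<in> multideg (r + 1)" "k < 3" "\<And>i. i < 3 \<Longrightarrow> i \<noteq> k \<Longrightarrow> 1 \<le> d i"
      by (auto simp: edge_idx_def all_idx_def)
    have "d (rot k) \<ge> 1" "d (rot (rot k)) \<ge> 1" using dk rot_neq[OF dk(3)] by auto
    then have r: "r \<ge> 1" using multideg_rot[OF dk(3,2)] by linarith
    have "lower d k \<in> multideg (r - 1)"
      using less_3_cases[OF dk(3)] dk(2) dk(4)[of 0] dk(4)[of 1] dk(4)[of 2]
      by (elim disjE) (auto simp: multideg_def lower_def)
    then have m: "mono3 (lower d k) \<in> poly3 (int r - 1)"
      using mono3_in_poly3[of _ "r - 1"] r by (simp add: of_nat_diff)
    \<comment> \<open>The pair i < j complementary to k is recognised by i + j + k = 3; the sign for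
      k = 1 is that of \<open>trT_contrX\<close>.\<close>
    define b where "b i j = (if i + j + k = 3 then if k = 1 then -1 else 1 else 0 :: real)" for i j
    have "wform p = trT (contrX (\<lambda>i j x. b i j * mono3 (lower d k) x))"
      using less_3_cases[OF dk(3)] by (intro ext) (auto simp: trT_contrX wform_def dk(1) b_def)
    moreover have "(\<lambda>x. b i j * mono3 (lower d k) x) \<in> poly3 (int r - 1)" for i j
      by (rule poly3_scale[OF m])
    ultimately show "wform p \<in> PmL1 r" unfolding PmL1_def by blast
  qed
  show "PmL1 r \<subseteq> form_span (edge_idx (r + 1)) wform"
  proof
    fix F assume "F \<in> PmL1 r"
    then obtain q where F: "F = trT (contrX q)"
      and q: "\<And>i j. i < j \<Longrightarrow> j < 3 \<Longrightarrow> q i j \<in> poly3 (int r - 1)"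
      unfolding PmL1_def by blast
    have q3: "q 1 2 \<in> poly3 (int r - 1)" "q 0 2 \<in> poly3 (int r - 1)" "q 0 1 \<in> poly3 (int r - 1)"
      using q by simp_all
    show "F \<in> form_span (edge_idx (r + 1)) wform"
    proof (cases r)
      case 0
      \<comment> \<open>For r = 0 the degree bound is -1, and the empty sum leaves only the zero
        polynomial.\<close>
      then have "q 1 2 = (\<lambda>x. 0)" "q 0 2 = (\<lambda>x. 0)" "q 0 1 = (\<lambda>x. 0)"
        using q3 by (auto simp: poly3_def)
      then have "F = (\<lambda>x v. 0)" unfolding F by (intro ext) (simp add: trT_contrX)
      then show ?thesis using form_span_zero by simp
    next
      case (Suc n)
      have part: "(\<lambda>x v. if in_T x \<and> tangentT v then p x * whitney k x v else 0) \<in> form_span (edge_idx (r + 1)) wform"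
        if p: "p \<in> poly3 (int r - 1)" and k: "k < 3" for p k
      proof -
        have "p \<in> poly3 (int n)" using p Suc by simp
        then obtain h where h: "\<And>x. in_T x \<Longrightarrow> p x = (\<Sum>e\<in>multideg n. h e * mono3 e x)"
          using poly3_homogenize by blast
        \<comment> \<open>The inverse of \<open>lower\<close>: it adds the multidegree of
          \<open>whitney k\<close> to that of the coefficient.\<close>
        define raise where "raise e i = (if i < 3 \<and> i \<noteq> k then e i + 1 else e i)" for e :: "nat \<Rightarrow> nat" and i
        have low: "lower (raise e) k = e" for e by (auto simp: lower_def raise_def fun_eq_iff)
        have idx: "(raise e, k) \<in> edge_idx (r + 1)" if "e \<in> multideg n" for e
          using less_3_cases[OF k] that Suc k by (auto simp: edge_idx_def all_idx_def raise_def multideg_def)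
        have "(\<lambda>x v. \<Sum>e\<in>multideg n. h e * wform (raise e, k) x v) \<in> form_span (edge_idx (r + 1)) wform"
          by (rule form_span_sum, rule form_span_base[OF finite_edge_idx idx])
        moreover have "(\<Sum>e\<in>multideg n. h e * wform (raise e, k) x v)
            = (if in_T x \<and> tangentT v then p x * whitney k x v else 0)" for x v
          by (cases "in_T x \<and> tangentT v") (auto simp: wform_def low h sum_distrib_right mult.assoc)
        ultimately show ?thesis by simp
      qed
      have "F = (\<lambda>x v. (if in_T x \<and> tangentT v then q 1 2 x * whitney 0 x v else 0)
          + ((-1) * (if in_T x \<and> tangentT v then q 0 2 x * whitney 1 x v else 0)
          + (if in_T x \<and> tangentT v then q 0 1 x * whitney 2 x v else 0)))"
        unfolding F by (intro ext) (simp add: trT_contrX)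
      also have "\<dots> \<in> form_span (edge_idx (r + 1)) wform"
        by (intro form_span_add form_span_scale part q3) simp_all
      finally show ?thesis .
    qed
  qed
qed

lemma whitney_face:
  assumes "i < 3" "k < 3" "k \<noteq> i" "x i = 0" "v i = 0"
  shows "whitney k x v = 0"
  using rot_cases[OF assms(1,2)] assms by (auto simp: whitney_def)

text \<open>On edge i only the forms with index i survive, and \<open>whitney i\<close> has no zero
  there, so the coefficients with \<open>d i = 0\<close> must vanish. No correction by relations
  occurs, since these live on multidegrees with all exponents positive.\<close>

lemma PmL1_0_eq_span: "PmL1_0 r = form_span (interior_idx (r + 1)) wform"
proof
  show "form_span (interior_idx (r + 1)) wform \<subseteq> PmL1_0 r"
  proof
    fix F assume F: "F \<in> form_span (interior_idx (r + 1)) wform"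
    have "form_span (interior_idx (r + 1)) wform \<subseteq> form_span (edge_idx (r + 1)) wform"
      by (rule form_span_mono, rule form_span_base[OF finite_edge_idx]) (use interior_idx_sub in auto)
    then have "F \<in> PmL1 r" using F by (auto simp: PmL1_eq_span)
    moreover obtain c where c: "\<And>x v. F x v = (\<Sum>i\<in>interior_idx (r + 1). c i * wform i x v)"
      using F unfolding form_span_iff by blast
    have "wform p x v = 0" if "p \<in> interior_idx (r + 1)" "i < 3" "x i = 0" "v i = 0" for p i x v
    proof (cases "snd p = i")
      case True
      then have "1 \<le> lower (fst p) (snd p) i" using that by (cases p) (auto simp: interior_idx_def lower_def)
      then have "mono3 (lower (fst p) (snd p)) x = 0" using that by (simp add: mono3_rot[OF that(2)])
      then show ?thesis by (simp add: wform_def)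
    next
      case False
      have "snd p < 3" using that by (cases p) (auto simp: interior_idx_def all_idx_def)
      then have "whitney (snd p) x v = 0" using whitney_face[of i "snd p" x v] False that by simp
      then show ?thesis by (simp add: wform_def)
    qed
    then have "zero_trace F" unfolding zero_trace_def c by (auto intro!: sum.neutral)
    ultimately show "F \<in> PmL1_0 r" by (simp add: PmL1_0_def)
  qed
  show "PmL1_0 r \<subseteq> form_span (interior_idx (r + 1)) wform"
  proof
    fix F assume F: "F \<in> PmL1_0 r"
    then have "F \<in> form_span (edge_idx (r + 1)) wform" by (simp add: PmL1_0_def PmL1_eq_span)
    then obtain c where c: "\<And>x v. F x v = (\<Sum>i\<in>edge_idx (r + 1). c i * wform i x v)"
      unfolding form_span_iff by blast
    define c' where "c' p = (if p \<in> edge_idx (r + 1) then c p else 0)" for p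
    have c': "F x v = (\<Sum>i\<in>all_idx (r + 1). c' i * wform i x v)" for x v
    proof -
      have "F x v = (\<Sum>i\<in>edge_idx (r + 1). c' i * wform i x v)" unfolding c by (simp add: c'_def)
      also have "\<dots> = (\<Sum>i\<in>all_idx (r + 1). c' i * wform i x v)"
        by (rule sum_idx_extend[OF edge_idx_sub]) (simp add: c'_def)
      finally show ?thesis .
    qed
    have c0: "c' (d, i) = 0" if i: "i < 3" and d: "d \<in> multideg (r + 1)" "d i = 0" for d i
    proof (rule mono3_indep_edge[where N = "r + 1" and a = "\<lambda>d. c' (d, i)", OF i _ d])
      fix x assume x: "in_T x" "x i = 0" "x (rot i) > 0" "x (rot (rot i)) > 0"
      \<comment> \<open>Oriented so that \<open>whitney i x ?v\<close> is the sum of the two nonzero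
        coordinates on the edge, which is 1.\<close>
      let ?v = "edge_vec (rot (rot i)) (rot i)"
      have v: "tangentT ?v" "?v i = 0" using tangentT_edge_vec i rot_neq[OF i] by (auto simp: edge_vec_def)
      have "x i + x (rot i) + x (rot (rot i)) = 1" using sum_rot[OF i, of x] x(1) by (simp add: in_T_def)
      then have wi: "whitney i x ?v = 1" using x(2) rot_neq[OF i] by (simp add: whitney_def edge_vec_def)
      have w: "wform (d, k) x ?v = 0" if "k < 3" "k \<noteq> i" for d k
        using whitney_face[of i k x ?v] i that x(2) v(2) by (simp add: wform_def)
      have "0 = F x ?v" using F x v i by (simp add: PmL1_0_def zero_trace_def)
      also have "\<dots> = (\<Sum>d\<in>multideg (r + 1). c' (d, i) * wform (d, i) x ?v)"
        unfolding c' using i rot_neq[OF i] by (simp add: sum_all_idx_rot[OF i] w)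
      also have "\<dots> = (\<Sum>d\<in>multideg (r + 1). c' (d, i) * mono3 (lower d i) x)"
        using x(1) v(1) by (simp add: wform_def wi)
      finally have "0 = (\<Sum>d\<in>multideg (r + 1). c' (d, i) * mono3 (lower d i) x) * (x (rot i) * x (rot (rot i)))"
        by simp
      \<comment> \<open>Where \<open>lower\<close> would truncate, \<open>c'\<close> is zero;
        elsewhere the two coordinates restore the full monomial, as needed for
        \<open>mono3_indep_edge\<close>.\<close>
      also have "\<dots> = (\<Sum>d\<in>multideg (r + 1). c' (d, i) * mono3 d x)"
        unfolding sum_distrib_right by (intro sum.cong refl) (simp add: c'_def mult.assoc mono3_lower)
      finally show "(\<Sum>d\<in>multideg (r + 1). c' (d, i) * mono3 d x) = 0" by simp
    qed
    have zero: "c' (d, k) = 0" if dk: "(d, k) \<in> all_idx (r + 1)" "(d, k) \<notin> interior_idx (r + 1)" for d k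
    proof (cases "(d, k) \<in> edge_idx (r + 1)")
      case True
      then have "d k = 0" using dk by (auto simp: edge_idx_def interior_idx_def)
      then show ?thesis using c0 dk(1) by (simp add: all_idx_def)
    qed (simp add: c'_def)
    have "F x v = (\<Sum>i\<in>interior_idx (r + 1). c' i * wform i x v)" for x v
      unfolding c'
      by (rule sum.mono_neutral_right[OF finite_all_idx subset_trans[OF interior_idx_sub edge_idx_sub]])
        (use zero in auto)
    then show "F \<in> form_span (interior_idx (r + 1)) wform" by (rule form_spanI)
  qed
qed

text \<open>Settles r = 0 in the third case: 3 divides 0, but a full multidegree would need positive
  exponents, so there is no obstruction. This is why the exceptional set there starts at 3.\<close>

lemma no_full_if_degree_zero:
  assumes "S3_family 0 I u s" "I \<subseteq> edge_idx 0"
  shows "\<not> S3_family.full I d"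
proof
  assume "S3_family.full I d"
  then have "(d, 0) \<in> I" by (simp add: S3_family.full_def[OF assms(1)])
  then have "(d, 0) \<in> edge_idx 0" using assms(2) by blast
  then have "1 \<le> d 1" "d \<in> multideg 0" by (auto simp: edge_idx_def all_idx_def)
  then show False by (simp add: multideg_def)
qed

theorem theorem4p1:
  fixes r :: nat
  shows "(has_S3_sign_invariant_basis (PL1 r) \<longleftrightarrow> r \<notin> {3 * m | m. True})
       \<and> (has_S3_sign_invariant_basis (PmL1 r) \<longleftrightarrow> r \<notin> {3 * m + 2 | m. True})
       \<and> (has_S3_sign_invariant_basis (PL1_0 r) \<longleftrightarrow> r \<notin> {3 * m + 3 | m. True})
       \<and> (has_S3_sign_invariant_basis (PmL1_0 r) \<longleftrightarrow> r \<notin> {3 * m + 2 | m. True})"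
proof (intro conjI)
  have P: "S3_family r (all_idx r) dform 1"
    by (rule S3_family_dform[OF subset_refl all_idx_fill all_idx_perm])
  have P0: "S3_family r (edge_idx r) dform 1"
    by (rule S3_family_dform[OF edge_idx_sub edge_idx_fill edge_idx_perm])
  have Pm: "S3_family (r + 1) (edge_idx (r + 1)) wform (-1)"
    by (rule S3_family_wform[OF subset_refl edge_idx_fill edge_idx_perm])
  have Pm0: "S3_family (r + 1) (interior_idx (r + 1)) wform (-1)"
    by (rule S3_family_wform[OF interior_idx_sub interior_idx_fill interior_idx_perm])
  have mod2: "r \<notin> {3 * m + 2 | m. True} \<longleftrightarrow> (r + 1) mod 3 \<noteq> 0" by simp presburger
  show "has_S3_sign_invariant_basis (PL1 r) \<longleftrightarrow> r \<notin> {3 * m | m. True}"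
  proof (cases "r mod 3 = 0")
    case True
    then obtain m where m: "r = 3 * m" by auto
    then have "(\<lambda>k. if k < 3 then m else 0, 0) \<in> all_idx r" by (simp add: all_idx_def multideg_def)
    then show ?thesis using S3_family.no_sign_invariant_basis[OF P] m by (auto simp: PL1_eq_span)
  next
    case False
    then show ?thesis using S3_family.sign_invariant_basis[OF P] by (auto simp: PL1_eq_span)
  qed
  show "has_S3_sign_invariant_basis (PL1_0 r) \<longleftrightarrow> r \<notin> {3 * m + 3 | m. True}"
  proof (cases "r mod 3 = 0 \<and> r \<noteq> 0")
    case True
    then have "r = 3 * (r div 3 - 1) + 3" by presburger
    then obtain m where m: "r = 3 * m + 3" by blast
    \<comment> \<open>The constant multidegree has entries r/3 = m + 1, which are positive as
      \<open>edge_idx\<close> demands.\<close>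
    then have "(\<lambda>k. if k < 3 then m + 1 else 0, 0) \<in> edge_idx r" by (simp add: edge_idx_def all_idx_def multideg_def)
    then show ?thesis using S3_family.no_sign_invariant_basis[OF P0, of "m + 1"] m by (auto simp: PL1_0_eq_span)
  next
    case False
    then have "r mod 3 \<noteq> 0 \<or> (\<forall>d. \<not> S3_family.full (edge_idx r) d)"
      using no_full_if_degree_zero[of "edge_idx r" dform 1] P0 by auto
    then have "has_S3_sign_invariant_basis (PL1_0 r)"
      using S3_family.sign_invariant_basis[OF P0] by (simp add: PL1_0_eq_span)
    moreover have "r \<notin> {3 * m + 3 | m. True}" using False by auto
    ultimately show ?thesis by simp
  qed
  have diag: "\<exists>m. (\<lambda>k. if k < 3 then m else 0, 0) \<in> interior_idx (r + 1)" if r: "(r + 1) mod 3 = 0"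
  proof -
    obtain m where "r + 1 = 3 * m" using r unfolding mod_eq_0_iff_dvd by (elim dvdE)
    \<comment> \<open>Since 3 m = r + 1 is positive, so is m. The same index serves both minus
      spaces, because \<open>interior_idx\<close> lies in \<open>edge_idx\<close>.\<close>
    then have "(\<lambda>k. if k < 3 then m else 0, 0) \<in> interior_idx (r + 1)"
      by (simp add: interior_idx_def all_idx_def multideg_def)
    then show ?thesis by blast
  qed
  show "has_S3_sign_invariant_basis (PmL1 r) \<longleftrightarrow> r \<notin> {3 * m + 2 | m. True}"
    unfolding mod2 PmL1_eq_span
    using S3_family.no_sign_invariant_basis[OF Pm] S3_family.sign_invariant_basis[OF Pm] diag interior_idx_sub
    by blast
  show "has_S3_sign_invariant_basis (PmL1_0 r) \<longleftrightarrow> r \<notin> {3 * m + 2 | m. True}"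
    unfolding mod2 PmL1_0_eq_span
    using S3_family.no_sign_invariant_basis[OF Pm0] S3_family.sign_invariant_basis[OF Pm0] diag
    by blast
qed

end
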